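(* Assume the Ultrapower Axiom. Suppose $U\in\mathrm{Un}$ and $W\in\mathrm{Un}^{M_U}$, and suppose that in $M_{U^2}$ we have $j_U(W)\mathrel{I}j_U(j_U)(W)$. Then $j^{M_U}_W(j_U(\xi))=j_U(\xi)$ for every ordinal $\xi$, i.e. $(j^{M_U}_W\circ j_U)\restriction\mathrm{Ord}=j_U\restriction\mathrm{Ord}$.
   Context: For a countably complete ultrafilter $U$, $j_U:V\to M_U$ is its ultrapower embedding; for an inner model $M$ and $Z\in M$ countably complete in $M$, $j^M_Z:M\to M^M_Z$ is the ultrapower computed in $M$. $\mathrm{Un}$ is the class of countably complete ultrafilters $U$ on ordinals $\lambda$ that are uniform ($\lambda\setminus\beta\in U$ for all $\beta<\lambda$), and $\mathrm{Un}^{M_U}$ is this class as computed in $M_U$. $M_{U^2}=j_U(M_U)=M^{M_U}_{j_U(U)}$, and $j_U(j_U):M_U\to M_{U^2}$ is the image of $j_U$ under $j_U$; thus $j_U(W)$ and $j_U(j_U)(W)$ lie in $\mathrm{Un}^{M_{U^2}}$. The internal relation (computed in a model): $U'\mathrel{I}W'$ iff $j_{U'}\restriction x\in M_{W'}$ for all $x\in M_{W'}$. The Ultrapower Axiom (UA): for all countably complete $U,W$ there are internal ultrapower embeddings $i_0:M_U\to N$, $i_1:M_W\to N$ (i.e. of the form $j^{M_U}_{Z_0}$, $j^{M_W}_{Z_1}$) with $i_0\circ j_U=i_1\circ j_W$. *)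

theory Defs
  imports Main
begin

text \<open>
  The universe of sets is a type equipped with an element function satisfying the ZFC axioms.
  Classes are HOL sets over that type, so the two schemes range over arbitrary HOL predicates and
  functions.
\<close>

class zfc =
  fixes elts :: "'a \<Rightarrow> 'a set"
  assumes extensionality: "elts x = elts y \<Longrightarrow> x = y"
    and foundation: "elts x \<noteq> {} \<Longrightarrow> \<exists>y\<in>elts x. elts y \<inter> elts x = {}"
    and pairing: "\<exists>z. elts z = {x, y}"
    and union: "\<exists>z. elts z = (\<Union>y\<in>elts x. elts y)"
    and power_set: "\<exists>z. elts z = {y. elts y \<subseteq> elts x}"
    and infinity: "\<exists>z. (\<exists>e\<in>elts z. elts e = {}) \<and>
                       (\<forall>x\<in>elts z. \<exists>y\<in>elts z. elts y = insert x (elts x))"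
    and separation: "\<exists>z. elts z = {y \<in> elts x. P y}"
    and replacement: "\<exists>z. elts z = F ` elts x"
    and choice: "\<lbrakk>\<forall>y\<in>elts x. elts y \<noteq> {};
                  \<forall>y\<in>elts x. \<forall>y'\<in>elts x. y \<noteq> y' \<longrightarrow> elts y \<inter> elts y' = {}\<rbrakk>
                 \<Longrightarrow> \<exists>c. \<forall>y\<in>elts x. \<exists>!w. w \<in> elts c \<inter> elts y"

text \<open>Only meaningful when the class \<open>C\<close> is coextensive with a set.\<close>

definition set_of :: "'v::zfc set \<Rightarrow> 'v" where
  "set_of C = (THE x. elts x = C)"

definition opair :: "'v::zfc \<Rightarrow> 'v \<Rightarrow> 'v" where
  "opair x y = set_of {set_of {x}, set_of {x, y}}"

definition is_fun :: "'v::zfc \<Rightarrow> 'v \<Rightarrow> bool" where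
  "is_fun f S \<longleftrightarrow> (\<forall>p\<in>elts f. \<exists>a\<in>elts S. \<exists>y. p = opair a y) \<and>
                 (\<forall>a\<in>elts S. \<exists>!y. opair a y \<in> elts f)"

definition app :: "'v::zfc \<Rightarrow> 'v \<Rightarrow> 'v" where
  "app f a = (THE y. opair a y \<in> elts f)"

definition restrict_fun :: "('v::zfc \<Rightarrow> 'v) \<Rightarrow> 'v \<Rightarrow> 'v" where
  "restrict_fun F S = set_of ((\<lambda>a. opair a (F a)) ` elts S)"

definition Ord :: "'v::zfc \<Rightarrow> bool" where
  "Ord x \<longleftrightarrow> (\<forall>y\<in>elts x. elts y \<subseteq> elts x) \<and> (\<forall>y\<in>elts x. \<forall>z\<in>elts y. elts z \<subseteq> elts y)"

primrec ord_of_nat :: "nat \<Rightarrow> 'v::zfc" where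
  "ord_of_nat 0 = set_of {}"
| "ord_of_nat (Suc n) = set_of (insert (ord_of_nat n) (elts (ord_of_nat n)))"

definition omega :: "'v::zfc" where
  "omega = set_of (range ord_of_nat)"

text \<open>
  In what follows \<open>M\<close> is a transitive class (an inner model), and each notion is its relativization
  to \<open>M\<close>: quantifiers over sets are bounded by \<open>M\<close>, while pairs, functions, ordinals, \<open>\<omega>\<close> and Boolean
  operations are absolute.  The unrelativized notion is the case \<open>M = UNIV\<close>.
\<close>

definition ultrafilter_on :: "'v::zfc set \<Rightarrow> 'v \<Rightarrow> 'v \<Rightarrow> bool" where
  "ultrafilter_on M S U \<longleftrightarrow>
     S \<in> M \<and> U \<in> M \<and>
     (\<forall>A\<in>elts U. elts A \<subseteq> elts S) \<and>
     S \<in> elts U \<and>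
     set_of {} \<notin> elts U \<and>
     (\<forall>A\<in>elts U. \<forall>B\<in>elts U. set_of (elts A \<inter> elts B) \<in> elts U) \<and>
     (\<forall>A\<in>elts U. \<forall>B\<in>M. elts A \<subseteq> elts B \<and> elts B \<subseteq> elts S \<longrightarrow> B \<in> elts U) \<and>
     (\<forall>A\<in>M. elts A \<subseteq> elts S \<longrightarrow> A \<in> elts U \<or> set_of (elts S - elts A) \<in> elts U)"

definition countably_complete_on :: "'v::zfc set \<Rightarrow> 'v \<Rightarrow> 'v \<Rightarrow> bool" where
  "countably_complete_on M S U \<longleftrightarrow>
     (\<forall>f\<in>M. is_fun f omega \<and> (\<forall>n\<in>elts omega. app f n \<in> elts U) \<longrightarrow>
        set_of {a \<in> elts S. \<forall>n\<in>elts omega. a \<in> elts (app f n)} \<in> elts U)"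

definition cc_ultrafilter :: "'v::zfc set \<Rightarrow> 'v \<Rightarrow> bool" where
  "cc_ultrafilter M U \<longleftrightarrow> (\<exists>S. ultrafilter_on M S U \<and> countably_complete_on M S U)"

definition Unif :: "'v::zfc set \<Rightarrow> 'v set" where
  "Unif M = {U. \<exists>\<kappa>. Ord \<kappa> \<and> ultrafilter_on M \<kappa> U \<and> countably_complete_on M \<kappa> U \<and>
                  (\<forall>\<beta>\<in>elts \<kappa>. set_of (elts \<kappa> - elts \<beta>) \<in> elts U)}"

text \<open>An ultrafilter on \<open>S\<close> has union \<open>S\<close>, so it determines its underlying set.\<close>

definition underlying :: "'v::zfc \<Rightarrow> 'v" where
  "underlying Z = set_of (\<Union>A\<in>elts Z. elts A)"

definition ult_funs :: "'v::zfc set \<Rightarrow> 'v \<Rightarrow> 'v set" where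
  "ult_funs M Z = {f \<in> M. is_fun f (underlying Z)}"

definition ult_mem :: "'v::zfc set \<Rightarrow> 'v \<Rightarrow> ('v \<times> 'v) set" where
  "ult_mem M Z = {(g, f). g \<in> ult_funs M Z \<and> f \<in> ult_funs M Z \<and>
                    set_of {a \<in> elts (underlying Z). app g a \<in> elts (app f a)} \<in> elts Z}"

text \<open>
  The point of the transitive ultrapower represented by \<open>f\<close>: the Mostowski collapse is applied
  directly to the representing functions, so that functions equal modulo \<open>Z\<close> have the same image.
  For \<open>Z\<close> countably complete in the inner model \<open>M\<close> the relation is well-founded, and the
  classes to which \<open>set_of\<close> is applied are coextensive with sets.
\<close>

definition ult_point :: "'v::zfc set \<Rightarrow> 'v \<Rightarrow> 'v \<Rightarrow> 'v" where
  "ult_point M Z = wfrec (ult_mem M Z) (\<lambda>\<pi> f. set_of (\<pi> ` {g. (g, f) \<in> ult_mem M Z}))"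

definition ultrapower :: "'v::zfc set \<Rightarrow> 'v \<Rightarrow> 'v set" where
  "ultrapower M Z = ult_point M Z ` ult_funs M Z"

definition ult_emb :: "'v::zfc set \<Rightarrow> 'v \<Rightarrow> 'v \<Rightarrow> 'v" where
  "ult_emb M Z x = ult_point M Z (restrict_fun (\<lambda>_. x) (underlying Z))"

definition internal_rel :: "'v::zfc set \<Rightarrow> 'v \<Rightarrow> 'v \<Rightarrow> bool" where
  "internal_rel M U W \<longleftrightarrow>
     (\<forall>x\<in>ultrapower M W. restrict_fun (ult_emb M U) x \<in> ultrapower M W)"

definition ultrapower_axiom :: "'v::zfc set \<Rightarrow> bool" where
  "ultrapower_axiom M \<longleftrightarrow>
     (\<forall>U W. cc_ultrafilter M U \<and> cc_ultrafilter M W \<longrightarrow>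
       (\<exists>Z\<^sub>0 Z\<^sub>1. cc_ultrafilter (ultrapower M U) Z\<^sub>0 \<and> cc_ultrafilter (ultrapower M W) Z\<^sub>1 \<and>
          ultrapower (ultrapower M U) Z\<^sub>0 = ultrapower (ultrapower M W) Z\<^sub>1 \<and>
          (\<forall>x\<in>M. ult_emb (ultrapower M U) Z\<^sub>0 (ult_emb M U x) =
                 ult_emb (ultrapower M W) Z\<^sub>1 (ult_emb M W x))))"

text \<open>
  The image \<open>j(C)\<close> of a class under an elementary embedding of the universe, which is usually
  written as the union of the sets \<open>j(C \<inter> V\<^sub>\<alpha>)\<close>; since \<open>j\<close> preserves inclusion, one may equally let
  \<open>x\<close> range over all sets.
\<close>

definition class_image :: "('v::zfc \<Rightarrow> 'v) \<Rightarrow> 'v set \<Rightarrow> 'v set" where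
  "class_image j C = (\<Union>x. elts (j (set_of (C \<inter> elts x))))"

definition class_graph :: "('v::zfc \<Rightarrow> 'v) \<Rightarrow> 'v set" where
  "class_graph F = range (\<lambda>x. opair x (F x))"

definition class_app :: "'v::zfc set \<Rightarrow> 'v \<Rightarrow> 'v" where
  "class_app G x = (THE y. opair x y \<in> G)"

abbreviation ultV :: "'v::zfc \<Rightarrow> 'v set" where
  "ultV U \<equiv> ultrapower UNIV U"

abbreviation embV :: "'v::zfc \<Rightarrow> 'v \<Rightarrow> 'v" where
  "embV U \<equiv> ult_emb UNIV U"

text \<open>The twice iterated ultrapower \<open>M_{U^2} = j_U(M_U)\<close>, and the embedding \<open>j_U(j_U)\<close> of \<open>M_U\<close> into it.\<close>

definition ult_sq :: "'v::zfc \<Rightarrow> 'v set" where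
  "ult_sq U = class_image (embV U) (ultV U)"

definition emb_of_emb :: "'v::zfc \<Rightarrow> 'v \<Rightarrow> 'v" where
  "emb_of_emb U = class_app (class_image (embV U) (class_graph (embV U)))"

end

theory Submission
  imports Defs Complex_Main "HOL-Library.FuncSet"
begin

text \<open>
  If \<open>W\<close> is represented by \<open>\<alpha> \<mapsto> W\<^sub>\<alpha>\<close>, the hypothesis says that \<open>W\<^sub>\<beta> I W\<^sub>\<alpha>\<close> for \<open>U\<close>-almost all \<open>\<alpha>\<close> and then
  almost all \<open>\<beta>\<close>, and the conclusion that the embedding of almost every \<open>W\<^sub>\<alpha>\<close> fixes \<open>\<xi>\<close>.  If it fails,
  there is a sequence of ultrafilters \<open>W\<^sub>n\<close>, all moving \<open>\<xi>\<close>, with \<open>W\<^sub>n I W\<^sub>m\<close> for all \<open>m < n\<close>.  The relation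
  \<open>F I D\<close> means that the quantifiers "for \<open>F\<close>-almost all \<open>a\<close>, for \<open>D\<close>-almost all \<open>d\<close>" can be exchanged at the
  cost of letting \<open>F\<close> depend on \<open>d\<close>.  Under the Ultrapower Axiom, \<open>U I W\<close>, \<open>U I D\<close> and \<open>W I D\<close> imply
  \<open>U I W \<times> D\<close>: compare \<open>U \<times> W \<times> D\<close> with \<open>W \<times> D\<close>; the seeds of \<open>W\<close> and \<open>D\<close> agree in the common target,
  because two internal embeddings of one model into another agree on ordinals.  Hence \<open>W\<^sub>n\<close> is internal
  to \<open>P\<^sub>n = W\<^bsub>n-1\<^esub> \<times> \<dots> \<times> W\<^sub>0\<close>, so that the \<open>P\<^sub>n\<close> form an internal iteration, in which \<open>\<xi>\<close> at every stage
  gives a descending sequence of ordinals of its direct limit; an infinite branch through the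
  measure one sets brings the descent back to the universe.
\<close>

section \<open>Sets and classes\<close>

text \<open>The pairwise relations \<open>W n I W m\<close> concern ultrafilters of the universe and
  give no iteration by themselves. With \<open>P (Suc n) = W n \<times> P n\<close>, the relation
  \<open>W n I P n\<close> says that the ultrapower by \<open>P (Suc n)\<close> is also an
  ultrapower of the one by \<open>P n\<close>, taken inside it, whose embedding is the restriction
  of the embedding of \<open>W n\<close>. Since that embedding moves \<xi> up, the \<xi> of stage
  \<open>Suc n\<close> lies below the image of the \<xi> of stage \<open>n\<close>. Ultrafilters are
  treated as HOL filters on arbitrary types, so that products and lists need no coding; an
  ultrafilter is replaced by a set only to invoke the Ultrapower Axiom and the agreement on
  ordinals.\<close>

definition small :: "'v::zfc set \<Rightarrow> bool" where
  "small C \<longleftrightarrow> (\<exists>z. elts z = C)"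

lemma elts_set_of [simp]: "small C \<Longrightarrow> elts (set_of C) = C"
  unfolding small_def set_of_def by (metis (mono_tags, lifting) extensionality theI)

lemma small_elts [simp]: "small (elts x)"
  by (auto simp: small_def)

lemma set_of_elts [simp]: "set_of (elts x) = x"
  by (simp add: extensionality)

lemma elts_inject: "elts x = elts y \<longleftrightarrow> x = y"
  by (metis extensionality)

lemma small_subset: "small B \<Longrightarrow> A \<subseteq> B \<Longrightarrow> small A"
proof -
  assume "small B" "A \<subseteq> B"
  then obtain b where "elts b = B" by (auto simp: small_def)
  moreover obtain z where "elts z = {y \<in> elts b. y \<in> A}"
    using separation [of b "\<lambda>y. y \<in> A"] by auto
  ultimately show ?thesis
    using \<open>A \<subseteq> B\<close> unfolding small_def by blast
qed

lemma small_Collect [simp]: "small {y \<in> elts b. P y}"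
  by (rule small_subset [OF small_elts]) auto

lemma small_Diff [simp]: "small (elts a - B)"
  by (rule small_subset [OF small_elts]) auto

lemma small_Int [simp]: "small (elts a \<inter> B)"
  by (rule small_subset [OF small_elts]) auto

lemma small_image: "small A \<Longrightarrow> small ((f :: 'v::zfc \<Rightarrow> 'v) ` A)"
  unfolding small_def by (auto intro: replacement)

lemma small_image_elts [simp]: "small ((f :: 'v::zfc \<Rightarrow> 'v) ` elts A)"
  by (simp add: small_image)

lemma small_UN:
  fixes A :: "'v::zfc set" and B :: "'v \<Rightarrow> 'v set"
  shows "small A \<Longrightarrow> (\<And>x. x \<in> A \<Longrightarrow> small (B x)) \<Longrightarrow> small (\<Union>x\<in>A. B x)"
proof -
  assume A: "small A" and B: "\<And>x. x \<in> A \<Longrightarrow> small (B x)"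
  obtain c where c: "elts c = (\<lambda>x. set_of (B x)) ` A"
    using small_image [OF A, of "\<lambda>x. set_of (B x)"] unfolding small_def by auto
  obtain z where "elts z = (\<Union>y\<in>elts c. elts y)"
    using union [of c] by auto
  also have "\<dots> = (\<Union>x\<in>A. B x)"
    using B by (auto simp: c)
  finally show ?thesis unfolding small_def by blast
qed

lemma small_pair [simp]: "small {x, y}"
  using pairing by (auto simp: small_def)

lemma small_singleton [simp]: "small {x}"
  using small_pair [of x x] by simp

lemma small_empty [simp]: "small {}"
  by (rule small_subset [OF small_singleton]) auto

lemma small_Un: "small A \<Longrightarrow> small B \<Longrightarrow> small (A \<union> B)"
  using small_UN [of "{set_of A, set_of B}" elts] by simp

lemma small_insert: "small A \<Longrightarrow> small (insert x A)"
  using small_Un [OF small_singleton, of A x] by simp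

lemma small_Pow: "small {y. elts y \<subseteq> elts x}"
  using power_set by (auto simp: small_def)

section \<open>Ordered pairs, natural numbers and ordinals\<close>

lemma elts_opair: "elts (opair x y) = {set_of {x}, set_of {x, y}}"
  by (simp add: opair_def)

lemma opair_inject [simp]: "opair x y = opair x' y' \<longleftrightarrow> x = x' \<and> y = y'"
proof
  assume "opair x y = opair x' y'"
  then have "{set_of {x}, set_of {x, y}} = {set_of {x'}, set_of {x', y'}}"
    by (metis elts_opair)
  then have "elts ` {set_of {x}, set_of {x, y}} = elts ` {set_of {x'}, set_of {x', y'}}"
    by simp
  then have "{{x}, {x, y}} = {{x'}, {x', y'}}"
    by simp
  then show "x = x' \<and> y = y'"
    by (metis doubleton_eq_iff insertI1 singletonD)
qed simp

lemma not_mem_self: "x \<notin> elts x"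
proof
  assume "x \<in> elts x"
  then show False
    using foundation [of "set_of {x}"] by auto
qed

lemma elts_ord_of_nat:
  "elts (ord_of_nat 0) = {}"
  "elts (ord_of_nat (Suc n)) = insert (ord_of_nat n) (elts (ord_of_nat n))"
  by (simp_all add: small_insert)

lemma ord_of_nat_less: "m < n \<Longrightarrow> ord_of_nat m \<in> elts (ord_of_nat n)"
  by (induction n) (auto simp: elts_ord_of_nat less_Suc_eq simp del: ord_of_nat.simps)

lemma inj_ord_of_nat: "inj ord_of_nat"
  by (rule injI) (metis linorder_neqE_nat not_mem_self ord_of_nat_less)

lemma small_range_ord_of_nat: "small (range ord_of_nat)"
proof -
  obtain z e where e: "e \<in> elts (z::'a)" "elts e = {}"
    and s: "\<forall>x\<in>elts z. \<exists>y\<in>elts z. elts y = insert x (elts x)"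
    using infinity by blast
  have "ord_of_nat n \<in> elts z" for n
  proof (induction n)
    case 0
    then show ?case using e by (metis elts_ord_of_nat(1) extensionality)
  next
    case (Suc n)
    then show ?case using s by (metis elts_ord_of_nat(2) extensionality)
  qed
  then show ?thesis
    by (intro small_subset [OF small_elts]) auto
qed

lemma elts_omega: "elts omega = range ord_of_nat"
  by (simp add: omega_def small_range_ord_of_nat)

lemma small_range_nat: "small (range (f :: nat \<Rightarrow> 'v::zfc))"
proof -
  have "range f = (\<lambda>x. f (inv ord_of_nat x)) ` range (ord_of_nat :: nat \<Rightarrow> 'v)"
    by (auto simp: image_iff inv_f_f [OF inj_ord_of_nat])
  then show ?thesis
    by (simp add: small_image small_range_ord_of_nat)
qed

text \<open>Replacement over arbitrary HOL functions makes the range of any HOL sequence a set, so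
  Foundation gives well-foundedness in the sense of HOL (\<open>wf_elts\<close>).\<close>

lemma no_descending_chain: "\<exists>n. f (Suc n) \<notin> elts (f n)"
proof (rule ccontr)
  assume "\<not> ?thesis"
  then show False
    using foundation [of "set_of (range f)"] by (auto simp: small_range_nat)
qed

lemma wf_elts: "wf {(x, y). x \<in> elts y}"
  unfolding wf_iff_no_infinite_down_chain using no_descending_chain by auto

lemma Ord_transitive: "Ord x \<Longrightarrow> y \<in> elts x \<Longrightarrow> z \<in> elts y \<Longrightarrow> z \<in> elts x"
  unfolding Ord_def by blast

lemma Ord_elts: "Ord x \<Longrightarrow> y \<in> elts x \<Longrightarrow> Ord y"
  unfolding Ord_def by blast

lemma Ord_linear: "Ord x \<Longrightarrow> Ord y \<Longrightarrow> x \<in> elts y \<or> x = y \<or> y \<in> elts x"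
proof (induction x arbitrary: y rule: wf_induct_rule [OF wf_elts])
  case (1 x)
  note IH1 = this
  show ?case
    using \<open>Ord y\<close>
  proof (induction y rule: wf_induct_rule [OF wf_elts])
    case (1 y)
    note IH2 = this
    show ?case
    proof (rule ccontr)
      assume neg: "\<not> ?case"
      have "z \<in> elts y" if "z \<in> elts x" for z
        using that neg IH1(1) [of z y] IH2(2) IH1(2) Ord_elts Ord_transitive by blast
      moreover have "z \<in> elts x" if "z \<in> elts y" for z
        using that neg IH2(1) [of z] IH2(2) IH1(2) Ord_elts Ord_transitive by blast
      ultimately have "elts x = elts y" by blast
      with neg show False by (simp add: elts_inject)
    qed
  qed
qed

lemma Ord_subset_cases:
  "Ord x \<Longrightarrow> Ord y \<Longrightarrow> elts x \<subseteq> elts y \<Longrightarrow> x = y \<or> x \<in> elts y"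
  using Ord_linear not_mem_self by blast

section \<open>Countably complete ultrafilters as filters\<close>

text \<open>The type argument names the universe, which a set of arbitrary type does not determine.\<close>

definition vsmall :: "'v::zfc itself \<Rightarrow> 'a set \<Rightarrow> bool" where
  "vsmall _ A \<longleftrightarrow> (\<exists>(S::'v) c. A \<subseteq> c ` elts S)"

lemma vsmall_subset: "vsmall TYPE('v::zfc) B \<Longrightarrow> A \<subseteq> B \<Longrightarrow> vsmall TYPE('v) A"
  unfolding vsmall_def by blast

lemma vsmall_image:
  assumes "vsmall TYPE('v::zfc) A"
  shows "vsmall TYPE('v) (f ` A)"
proof -
  obtain S :: 'v and c where "A \<subseteq> c ` elts S"
    using assms unfolding vsmall_def by blast
  then have "f ` A \<subseteq> (f \<circ> c) ` elts S" by auto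
  then show ?thesis unfolding vsmall_def by blast
qed

lemma vsmall_iff_small: "vsmall TYPE('v::zfc) (A :: 'v set) \<longleftrightarrow> small A"
proof
  assume "vsmall TYPE('v) A"
  then show "small A"
    unfolding vsmall_def using small_subset small_image_elts by blast
next
  assume "small A"
  then obtain a where "elts a = A" by (auto simp: small_def)
  then have "A \<subseteq> id ` elts a" by simp
  then show "vsmall TYPE('v) A" unfolding vsmall_def by blast
qed

lemma vsmall_UN:
  fixes A :: "'a set" and B :: "'a \<Rightarrow> 'b set"
  assumes "vsmall TYPE('v::zfc) A" "\<And>x. x \<in> A \<Longrightarrow> vsmall TYPE('v) (B x)"
  shows "vsmall TYPE('v) (\<Union>x\<in>A. B x)"
proof -
  obtain S :: 'v and c where Sc: "A \<subseteq> c ` elts S"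
    using assms(1) unfolding vsmall_def by blast
  have "\<forall>x. \<exists>(R::'v) d. x \<in> A \<longrightarrow> B x \<subseteq> d ` elts R"
    using assms(2) unfolding vsmall_def by blast
  then obtain R :: "'a \<Rightarrow> 'v" and d where Rd: "\<And>x. x \<in> A \<Longrightarrow> B x \<subseteq> d x ` elts (R x)"
    by metis
  define Z where "Z = (\<Union>s\<in>elts S. opair s ` elts (R (c s)))"
  have Z: "elts (set_of Z) = Z"
    unfolding Z_def by (simp add: small_UN)
  define p1 p2 :: "'v \<Rightarrow> 'v"
    where "p1 = (\<lambda>p. SOME a. \<exists>b. p = opair a b)" and "p2 = (\<lambda>p. SOME b. \<exists>a. p = opair a b)"
  have p [simp]: "p1 (opair a b) = a" "p2 (opair a b) = b" for a b
    by (auto simp: p1_def p2_def)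
  have "(\<Union>x\<in>A. B x) \<subseteq> (\<lambda>p. d (c (p1 p)) (p2 p)) ` Z"
  proof
    fix y assume "y \<in> (\<Union>x\<in>A. B x)"
    then obtain x where "x \<in> A" "y \<in> B x" by blast
    moreover then obtain s r where "s \<in> elts S" "x = c s" "r \<in> elts (R x)" "y = d x r"
      using Sc Rd by blast
    ultimately have "y = d (c (p1 (opair s r))) (p2 (opair s r))" "opair s r \<in> Z"
      by (auto simp: Z_def)
    then show "y \<in> (\<lambda>p. d (c (p1 p)) (p2 p)) ` Z" by blast
  qed
  then show ?thesis
    unfolding vsmall_def by (metis Z)
qed

lemma small_Sigma: "small ((\<lambda>(a, b). opair a b) ` (Sigma (elts A) (\<lambda>a. elts (B a))))"
proof -
  have "(\<lambda>(a, b). opair a b) ` (Sigma (elts A) (\<lambda>a. elts (B a)))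
      = (\<Union>a\<in>elts A. opair a ` elts (B a))"
    by auto
  then show ?thesis by (simp add: small_UN)
qed

text \<open>Bounds the number of representing functions; in \<open>elts_pt\<close> this makes every
  point of the collapse a set. \<open>D\<close> recovers a function from its graph, a subset of the
  set \<open>P\<close> of pairs.\<close>

lemma vsmall_PiE:
  fixes A :: "'a set" and B :: "'v::zfc set"
  assumes "vsmall TYPE('v) A" "small B"
  shows "vsmall TYPE('v) (A \<rightarrow>\<^sub>E B)"
proof -
  obtain S :: 'v and c where Sc: "A \<subseteq> c ` elts S"
    using assms(1) unfolding vsmall_def by blast
  define e where "e x = (SOME s. s \<in> elts S \<and> c s = x)" for x
  have e: "e x \<in> elts S" "c (e x) = x" if "x \<in> A" for x
    unfolding e_def using someI_ex [of "\<lambda>s. s \<in> elts S \<and> c s = x"] that Sc by blast+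
  obtain b where b: "elts b = B" using assms(2) by (auto simp: small_def)
  define P where "P = set_of ((\<lambda>(a, b). opair a b) ` (Sigma (elts S) (\<lambda>a. elts b)))"
  have P: "elts P = (\<lambda>(a, b). opair a b) ` (Sigma (elts S) (\<lambda>a. elts b))"
    unfolding P_def by (rule elts_set_of [OF small_Sigma])
  define D where "D z = (\<lambda>x\<in>A. THE y. opair (e x) y \<in> elts z)" for z
  have "f \<in> D ` {z. elts z \<subseteq> elts P}" if f: "f \<in> A \<rightarrow>\<^sub>E B" for f
  proof -
    define C where "C = (\<lambda>x. opair (e x) (f x)) ` A"
    have C: "C \<subseteq> elts P"
      using f e by (auto simp: C_def P b)
    then have eC: "elts (set_of C) = C"
      using elts_set_of small_subset [OF small_elts] by blast
    have "D (set_of C) = f"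
    proof
      fix x
      show "D (set_of C) x = f x"
      proof (cases "x \<in> A")
        case True
        have "y = f x" if "opair (e x) y \<in> C" for y
          using that e(2) [OF True] e(2) unfolding C_def by auto
        moreover have "opair (e x) (f x) \<in> C" using True by (auto simp: C_def)
        ultimately have "(THE y. opair (e x) y \<in> C) = f x"
          by (intro the_equality)
        then show ?thesis
          using True by (simp add: D_def eC)
      next
        case False
        then show ?thesis using f by (auto simp: D_def)
      qed
    qed
    then show ?thesis using C eC by (metis (mono_tags, lifting) imageI mem_Collect_eq)
  qed
  then have "(A \<rightarrow>\<^sub>E B) \<subseteq> D ` elts (set_of {z. elts z \<subseteq> elts P})"
    by (simp add: small_Pow subsetI)
  then show ?thesis unfolding vsmall_def by blast
qed

text \<open>The last clause asks for a set-sized large collection even if \<open>'a\<close> is as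
  big as the universe; it keeps the ultrapower relation set-like.\<close>

definition ccuf :: "'v::zfc itself \<Rightarrow> 'a filter \<Rightarrow> bool" where
  "ccuf T F \<longleftrightarrow> F \<noteq> bot \<and>
     (\<forall>P. eventually P F \<or> eventually (\<lambda>x. \<not> P x) F) \<and>
     (\<forall>P :: nat \<Rightarrow> 'a \<Rightarrow> bool. (\<forall>n. eventually (P n) F) \<longrightarrow> eventually (\<lambda>x. \<forall>n. P n x) F) \<and>
     (\<exists>A. vsmall T A \<and> eventually (\<lambda>x. x \<in> A) F)"

section \<open>The quantifier "for almost all" of an ultrafilter\<close>

lemma eventually_not:
  assumes "ccuf T F"
  shows "eventually (\<lambda>x. \<not> P x) F \<longleftrightarrow> \<not> eventually P F"
proof -
  have "\<not> (eventually (\<lambda>x. \<not> P x) F \<and> eventually P F)"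
    using assms unfolding ccuf_def eventually_conj_iff [symmetric]
    by (simp flip: trivial_limit_def add: eventually_False)
  then show ?thesis
    using assms unfolding ccuf_def by blast
qed

lemma eventually_imp: "ccuf T F \<Longrightarrow>
    eventually (\<lambda>x. P x \<longrightarrow> Q x) F \<longleftrightarrow> (eventually P F \<longrightarrow> eventually Q F)"
proof -
  assume F: "ccuf T F"
  have "eventually (\<lambda>x. P x \<longrightarrow> Q x) F \<longleftrightarrow> \<not> eventually (\<lambda>x. P x \<and> \<not> Q x) F"
    by (simp flip: eventually_not [OF F])
  then show ?thesis by (simp add: eventually_conj_iff eventually_not [OF F])
qed

lemma eventually_disj: "ccuf T F \<Longrightarrow>
    eventually (\<lambda>x. P x \<or> Q x) F \<longleftrightarrow> (eventually P F \<or> eventually Q F)"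
  using eventually_imp [of T F "\<lambda>x. \<not> P x" Q] eventually_not [of T F P] by (simp add: disj_imp)

lemma eventually_countable:
  fixes P :: "nat \<Rightarrow> 'a \<Rightarrow> bool"
  shows "ccuf T F \<Longrightarrow> eventually (\<lambda>x. \<forall>n. P n x) F \<longleftrightarrow> (\<forall>n. eventually (P n) F)"
proof
  assume "ccuf T F" "\<forall>n. eventually (P n) F"
  then show "eventually (\<lambda>x. \<forall>n. P n x) F" unfolding ccuf_def by blast
next
  assume *: "eventually (\<lambda>x. \<forall>n. P n x) F"
  show "\<forall>n. eventually (P n) F"
    by (intro allI, rule eventually_mono [OF *]) blast
qed

lemma eventually_const_iff: "ccuf T F \<Longrightarrow> eventually (\<lambda>x. c) F \<longleftrightarrow> c"
  unfolding ccuf_def by (cases c) (auto simp: eventually_False)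

text \<open>The existential step of Los' theorem: a witness is chosen at each point.
  \<open>eventually_all_iff\<close> is its dual.\<close>

lemma eventually_ex_iff: "eventually (\<lambda>x. \<exists>y. P x y) F \<longleftrightarrow> (\<exists>g. eventually (\<lambda>x. P x (g x)) F)"
proof
  assume "eventually (\<lambda>x. \<exists>y. P x y) F"
  then have "eventually (\<lambda>x. P x (SOME y. P x y)) F"
    by (rule eventually_mono) (rule someI_ex)
  then show "\<exists>g. eventually (\<lambda>x. P x (g x)) F" by (rule exI [where x = "\<lambda>x. SOME y. P x y"])
next
  assume "\<exists>g. eventually (\<lambda>x. P x (g x)) F"
  then obtain g where *: "eventually (\<lambda>x. P x (g x)) F" by blast
  show "eventually (\<lambda>x. \<exists>y. P x y) F" by (rule eventually_mono [OF *]) blast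
qed

lemma eventually_all_iff:
  "ccuf T F \<Longrightarrow> eventually (\<lambda>x. \<forall>y. P x y) F \<longleftrightarrow> (\<forall>g. eventually (\<lambda>x. P x (g x)) F)"
  using eventually_ex_iff [of "\<lambda>x y. \<not> P x y" F] eventually_not [of T F "\<lambda>x. \<exists>y. \<not> P x y"]
  by (simp add: eventually_not)

lemma eventually_happens_ccuf: "ccuf T F \<Longrightarrow> eventually P F \<Longrightarrow> \<exists>x. P x"
  unfolding ccuf_def using eventually_happens by blast

text \<open>The sum of the ultrafilters \<open>G x\<close> along \<open>F\<close>, with the
  coordinate of \<open>F\<close> outermost; for constant \<open>G\<close> it is the product
  \<open>F \<times> G\<close>.\<close>

definition dsum :: "'a filter \<Rightarrow> ('a \<Rightarrow> 'b filter) \<Rightarrow> ('a \<times> 'b) filter" where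
  "dsum F G = Abs_filter (\<lambda>P. \<forall>\<^sub>F x in F. \<forall>\<^sub>F y in G x. P (x, y))"

lemma eventually_dsum: "eventually P (dsum F G) \<longleftrightarrow> (\<forall>\<^sub>F x in F. \<forall>\<^sub>F y in G x. P (x, y))"
  unfolding dsum_def
proof (rule eventually_Abs_filter, rule is_filter.intro)
  show "\<forall>\<^sub>F x in F. \<forall>\<^sub>F y in G x. P (x, y) \<and> Q (x, y)"
    if "\<forall>\<^sub>F x in F. \<forall>\<^sub>F y in G x. P (x, y)" "\<forall>\<^sub>F x in F. \<forall>\<^sub>F y in G x. Q (x, y)" for P Q
    using that by (simp add: eventually_conj_iff)
  show "\<forall>\<^sub>F x in F. \<forall>\<^sub>F y in G x. Q (x, y)"
    if "\<forall>x. P x \<longrightarrow> Q x" "\<forall>\<^sub>F x in F. \<forall>\<^sub>F y in G x. P (x, y)" for P Q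
    using that(2) by (rule eventually_mono) (use that(1) in \<open>auto elim: eventually_mono\<close>)
qed simp

lemma ccuf_dsum:
  assumes F: "ccuf TYPE('v::zfc) F" and G: "\<forall>\<^sub>F x in F. ccuf TYPE('v) (G x)"
  shows "ccuf TYPE('v) (dsum F G)"
  unfolding ccuf_def
proof (intro conjI allI impI)
  show "dsum F G \<noteq> bot"
  proof
    assume "dsum F G = bot"
    then have "\<forall>\<^sub>F x in F. \<forall>\<^sub>F y in G x. False"
      using eventually_dsum [of "\<lambda>_. False" F G] by simp
    with G have "\<forall>\<^sub>F x in F. False"
      by (rule eventually_elim2) (simp add: eventually_const_iff)
    then show False using F by (simp add: eventually_const_iff)
  qed
  show "eventually P (dsum F G) \<or> eventually (\<lambda>x. \<not> P x) (dsum F G)" for P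
  proof -
    have "\<forall>\<^sub>F x in F. (\<forall>\<^sub>F y in G x. P (x, y)) \<or> (\<forall>\<^sub>F y in G x. \<not> P (x, y))"
      by (rule eventually_mono [OF G]) (simp add: eventually_not)
    then show ?thesis by (simp add: eventually_dsum eventually_disj [OF F])
  qed
  show "eventually (\<lambda>x. \<forall>n. P n x) (dsum F G)" if "\<forall>n. eventually (P n) (dsum F G)"
    for P :: "nat \<Rightarrow> _"
  proof -
    have "\<forall>\<^sub>F x in F. \<forall>n. \<forall>\<^sub>F y in G x. P n (x, y)"
      using that by (simp add: eventually_dsum eventually_countable [OF F])
    with G show ?thesis
      unfolding eventually_dsum by (rule eventually_elim2) (simp add: eventually_countable)
  qed
  obtain A where A: "vsmall TYPE('v) A" "\<forall>\<^sub>F x in F. x \<in> A"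
    using F unfolding ccuf_def by blast
  have "\<forall>\<^sub>F x in F. \<exists>B. vsmall TYPE('v) B \<and> (\<forall>\<^sub>F y in G x. y \<in> B)"
    by (rule eventually_mono [OF G]) (auto simp: ccuf_def)
  then obtain B where B: "\<forall>\<^sub>F x in F. vsmall TYPE('v) (B x) \<and> (\<forall>\<^sub>F y in G x. y \<in> B x)"
    unfolding eventually_ex_iff by blast
  \<comment> \<open>\<open>B x\<close> is known to be small only for almost all \<open>x\<close>;
    the other points are dropped from the support.\<close>
  define A' where "A' = {x\<in>A. vsmall TYPE('v) (B x)}"
  have "vsmall TYPE('v) (\<Union>x\<in>A'. Pair x ` B x)"
    by (rule vsmall_UN) (use A(1) in \<open>auto simp: A'_def intro: vsmall_image vsmall_subset\<close>)
  moreover have "eventually (\<lambda>p. p \<in> (\<Union>x\<in>A'. Pair x ` B x)) (dsum F G)"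
    unfolding eventually_dsum using A(2) B
  proof eventually_elim
    case (elim x)
    have "\<forall>\<^sub>F y in G x. y \<in> B x" using elim by blast
    then show ?case
      by (rule eventually_mono) (use elim in \<open>auto simp: A'_def\<close>)
  qed
  ultimately show "\<exists>A. vsmall TYPE('v) A \<and> eventually (\<lambda>x. x \<in> A) (dsum F G)" by blast
qed

lemma ccuf_filtermap:
  assumes "ccuf TYPE('v::zfc) F" shows "ccuf TYPE('v) (filtermap k F)"
  unfolding ccuf_def eventually_filtermap
proof (intro conjI allI impI)
  show "filtermap k F \<noteq> bot" using assms by (simp add: ccuf_def filtermap_bot_iff)
  show "\<exists>A. vsmall TYPE('v) A \<and> (\<forall>\<^sub>F x in F. k x \<in> A)"
  proof -
    obtain A where A: "vsmall TYPE('v) A" "\<forall>\<^sub>F x in F. x \<in> A"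
      using assms unfolding ccuf_def by blast
    have "\<forall>\<^sub>F x in F. k x \<in> k ` A" using A(2) by (rule eventually_mono) simp
    then show ?thesis using vsmall_image [OF A(1)] by blast
  qed
qed (auto simp: eventually_not [OF assms] eventually_countable [OF assms])

section \<open>Ultrapowers\<close>

text \<open>\<open>pt F f\<close> is the point of the transitive collapse that is represented by \<open>f\<close>.\<close>

definition pt :: "'a filter \<Rightarrow> ('a \<Rightarrow> 'v::zfc) \<Rightarrow> 'v" where
  "pt F = wfrec {(g, f). \<forall>\<^sub>F x in F. g x \<in> elts (f x)}
            (\<lambda>\<pi> f. set_of (\<pi> ` {g. \<forall>\<^sub>F x in F. g x \<in> elts (f x)}))"

context
  fixes F :: "'a filter"
  assumes F: "ccuf TYPE('v::zfc) F"
begin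

text \<open>Countable completeness yields one point lying in the countably many large sets given by
  a descending sequence of functions; the values there would descend in the universe.\<close>

lemma wf_ult: "wf {(g, f). \<forall>\<^sub>F x in F. g x \<in> elts (f x :: 'v)}"
  unfolding wf_iff_no_infinite_down_chain
proof
  assume "\<exists>f. \<forall>i. (f (Suc i), f i) \<in> {(g, f). \<forall>\<^sub>F x in F. g x \<in> elts (f x :: 'v)}"
  then obtain f :: "nat \<Rightarrow> 'a \<Rightarrow> 'v" where "\<forall>i. \<forall>\<^sub>F x in F. f (Suc i) x \<in> elts (f i x)"
    by auto
  then have "\<forall>\<^sub>F x in F. \<forall>i. f (Suc i) x \<in> elts (f i x)"
    using eventually_countable [OF F, of "\<lambda>i x. f (Suc i) x \<in> elts (f i x)"] by blast
  then obtain x where "\<forall>i. f (Suc i) x \<in> elts (f i x)"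
    using eventually_happens_ccuf [OF F] by blast
  then show False using no_descending_chain [of "\<lambda>i. f i x"] by blast
qed

lemma pt_unfold: "pt F (f :: 'a \<Rightarrow> 'v) = set_of (pt F ` {g. \<forall>\<^sub>F x in F. g x \<in> elts (f x)})"
proof -
  have "pt F f = set_of (cut (pt F) {(g, f). \<forall>\<^sub>F x in F. g x \<in> elts (f x)} f `
                  {g. \<forall>\<^sub>F x in F. g x \<in> elts (f x)})"
    unfolding pt_def by (subst wfrec [OF wf_ult]) (simp add: pt_def)
  also have "cut (pt F) {(g, f). \<forall>\<^sub>F x in F. g x \<in> elts (f x)} f ` {g. \<forall>\<^sub>F x in F. g x \<in> elts (f x)}
      = pt F ` {g. \<forall>\<^sub>F x in F. g x \<in> elts (f x)}"
    by (rule image_cong) (simp_all add: cut_apply)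
  finally show ?thesis .
qed

lemma pt_cong:
  fixes f g :: "'a \<Rightarrow> 'v"
  assumes "\<forall>\<^sub>F x in F. f x = g x" shows "pt F f = pt F g"
proof -
  have "(\<forall>\<^sub>F x in F. h x \<in> elts (f x)) \<longleftrightarrow> (\<forall>\<^sub>F x in F. h x \<in> elts (g x))" for h
    by (rule eventually_subst) (rule eventually_mono [OF assms], simp)
  then show ?thesis by (subst (1 2) pt_unfold) simp
qed

text \<open>The relation is set-like: modulo \<open>F\<close>, a function below \<open>f\<close> has
  its values on a support \<open>A\<close> in one set \<open>B\<close>, and such functions are
  bounded by \<open>vsmall_PiE\<close>.\<close>

lemma elts_pt: "elts (pt F (f :: 'a \<Rightarrow> 'v)) = {pt F g |g. \<forall>\<^sub>F x in F. g x \<in> elts (f x)}"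
proof -
  obtain A where A: "vsmall TYPE('v) A" "\<forall>\<^sub>F x in F. x \<in> A"
    using F unfolding ccuf_def by blast
  define B where "B = (\<Union>x\<in>A. elts (f x))"
  have "small B"
  proof -
    have "vsmall TYPE('v) B" unfolding B_def
      by (rule vsmall_UN [OF A(1)]) (simp add: vsmall_iff_small)
    then show ?thesis by (simp add: vsmall_iff_small)
  qed
  have "pt F ` {g. \<forall>\<^sub>F x in F. g x \<in> elts (f x)} \<subseteq> pt F ` (A \<rightarrow>\<^sub>E insert undefined B)"
  proof clarify
    fix g assume g: "\<forall>\<^sub>F x in F. g x \<in> elts (f x)"
    \<comment> \<open>\<open>undefined\<close> is the value where
      \<open>g x \<in> elts (f x)\<close> fails, hence the bound
      \<open>insert undefined B\<close>.\<close>
    define h where "h = (\<lambda>x\<in>A. if g x \<in> elts (f x) then g x else undefined)"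
    have "\<forall>\<^sub>F x in F. g x = h x"
      using g A(2) by (rule eventually_elim2) (simp add: h_def)
    then have "pt F g = pt F h" by (rule pt_cong)
    moreover have "h \<in> A \<rightarrow>\<^sub>E insert undefined B"
      by (auto simp: h_def B_def)
    ultimately show "pt F g \<in> pt F ` (A \<rightarrow>\<^sub>E insert undefined B)"
      by simp
  qed
  moreover have "small (pt F ` (A \<rightarrow>\<^sub>E insert undefined B))"
  proof -
    have "vsmall TYPE('v) (A \<rightarrow>\<^sub>E insert undefined B)"
      by (rule vsmall_PiE [OF A(1)]) (simp add: small_insert \<open>small B\<close>)
    then have "vsmall TYPE('v) (pt F ` (A \<rightarrow>\<^sub>E insert undefined B))"
      by (rule vsmall_image)
    then show ?thesis by (simp add: vsmall_iff_small)
  qed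
  ultimately have "small (pt F ` {g. \<forall>\<^sub>F x in F. g x \<in> elts (f x)})"
    using small_subset by blast
  then show ?thesis by (subst pt_unfold) auto
qed

text \<open>If \<open>f\<close> and \<open>g\<close> differ almost everywhere, then almost
  everywhere the same one of them has an element missing from the other; a choice \<open>h\<close>
  of it contradicts the induction hypothesis. As the induction is on \<open>f\<close> alone, the
  hypothesis is applied to \<open>h'\<close> instead of \<open>h\<close> in the second case.\<close>

lemma pt_eq_iff: "pt F (f :: 'a \<Rightarrow> 'v) = pt F g \<longleftrightarrow> (\<forall>\<^sub>F x in F. f x = g x)"
proof
  show "pt F f = pt F g \<Longrightarrow> \<forall>\<^sub>F x in F. f x = g x"
  proof (induction f arbitrary: g rule: wf_induct_rule [OF wf_ult])
    case (1 f)
    show ?case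
    proof (rule ccontr)
      assume "\<not> ?case"
      then have "\<forall>\<^sub>F x in F. f x \<noteq> g x" by (simp add: eventually_not [OF F])
      then have "\<forall>\<^sub>F x in F. (\<exists>y. y \<in> elts (f x) \<and> y \<notin> elts (g x)) \<or>
                              (\<exists>y. y \<in> elts (g x) \<and> y \<notin> elts (f x))"
        by (rule eventually_mono) (auto simp flip: elts_inject)
      then consider
          "\<exists>h. \<forall>\<^sub>F x in F. h x \<in> elts (f x) \<and> h x \<notin> elts (g x)"
        | "\<exists>h. \<forall>\<^sub>F x in F. h x \<in> elts (g x) \<and> h x \<notin> elts (f x)"
        unfolding eventually_disj [OF F] eventually_ex_iff by blast
      then show False
      proof cases
        case 1
        then obtain h where h: "\<forall>\<^sub>F x in F. h x \<in> elts (f x)" "\<forall>\<^sub>F x in F. h x \<notin> elts (g x)"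
          by (auto simp: eventually_conj_iff)
        then have "pt F h \<in> elts (pt F g)"
          unfolding "1.prems" [symmetric] by (auto simp: elts_pt)
        then obtain h' where h': "pt F h = pt F h'" "\<forall>\<^sub>F x in F. h' x \<in> elts (g x)"
          by (auto simp: elts_pt)
        then have "\<forall>\<^sub>F x in F. h x = h' x"
          using "1.IH" h(1) by blast
        with h(2) h'(2) have "\<forall>\<^sub>F x in F. False"
          by eventually_elim simp
        then show False using F by (simp add: eventually_const_iff)
      next
        case 2
        then obtain h where h: "\<forall>\<^sub>F x in F. h x \<in> elts (g x)" "\<forall>\<^sub>F x in F. h x \<notin> elts (f x)"
          by (auto simp: eventually_conj_iff)
        then have "pt F h \<in> elts (pt F f)"
          unfolding "1.prems" by (auto simp: elts_pt)
        then obtain h' where h': "pt F h' = pt F h" "\<forall>\<^sub>F x in F. h' x \<in> elts (f x)"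
          by (auto simp: elts_pt)
        then have "\<forall>\<^sub>F x in F. h' x = h x"
          using "1.IH" h' by blast
        with h(2) h'(2) have "\<forall>\<^sub>F x in F. False"
          by eventually_elim simp
        then show False using F by (simp add: eventually_const_iff)
      qed
    qed
  qed
qed (rule pt_cong)

lemma pt_mem_iff: "pt F (f :: 'a \<Rightarrow> 'v) \<in> elts (pt F g) \<longleftrightarrow> (\<forall>\<^sub>F x in F. f x \<in> elts (g x))"
proof
  assume "pt F f \<in> elts (pt F g)"
  then obtain h where h: "\<forall>\<^sub>F x in F. f x = h x" "\<forall>\<^sub>F x in F. h x \<in> elts (g x)"
    by (auto simp: elts_pt pt_eq_iff)
  then show "\<forall>\<^sub>F x in F. f x \<in> elts (g x)" by eventually_elim simp
qed (auto simp: elts_pt)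

lemma mem_ptE:
  assumes "y \<in> elts (pt F (f :: 'a \<Rightarrow> 'v))"
  obtains g where "y = pt F g" "\<forall>\<^sub>F x in F. g x \<in> elts (f x)"
  using assms by (auto simp: elts_pt)

lemma range_pt_transitive: "y \<in> elts (x :: 'v) \<Longrightarrow> x \<in> range (pt F) \<Longrightarrow> y \<in> range (pt F)"
  by (auto elim: mem_ptE)

text \<open>The tool for computing representatives: a set of points is determined by which
  \<open>pt F g\<close> belong to it, so pairs, differences or \<open>omega\<close> are found
  without inspecting the recursion.\<close>

lemma pt_eqI:
  fixes z :: 'v
  assumes "elts z \<subseteq> range (pt F)"
    and "\<And>g. pt F g \<in> elts z \<longleftrightarrow> (\<forall>\<^sub>F x in F. g x \<in> elts (f x))"
  shows "pt F f = z"
proof (rule extensionality)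
  show "elts (pt F f) = elts z"
  proof (intro equalityI subsetI)
    fix y assume "y \<in> elts (pt F f)"
    then show "y \<in> elts z" using assms(2) by (auto elim!: mem_ptE)
  next
    fix y assume y: "y \<in> elts z"
    then obtain g where "y = pt F g" using assms(1) by blast
    then show "y \<in> elts (pt F f)" using y assms(2) by (simp add: pt_mem_iff)
  qed
qed

end

text \<open>\<open>k\<close> is injective on a large set, so every function on its domain agrees
  almost everywhere with one that factors through \<open>k\<close>.\<close>

lemma pt_filtermap:
  fixes f :: "'b \<Rightarrow> 'v::zfc"
  assumes F: "ccuf TYPE('v) F" and k: "\<forall>\<^sub>F x in F. k' (k x) = x"
  shows "pt (filtermap k F) f = pt F (f \<circ> k)"
proof (induction f rule: wf_induct_rule [OF wf_ult [OF ccuf_filtermap [OF F, of k]]])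
  case (1 f)
  note K = ccuf_filtermap [OF F, of k]
  show ?case
  proof (rule extensionality, intro equalityI subsetI)
    fix y assume "y \<in> elts (pt (filtermap k F) f)"
    then obtain g where g: "y = pt (filtermap k F) g" "\<forall>\<^sub>F x in F. g (k x) \<in> elts (f (k x))"
      by (auto simp: elts_pt [OF K] eventually_filtermap)
    then show "y \<in> elts (pt F (f \<circ> k))"
      using 1 [of g] by (simp add: pt_mem_iff [OF F] eventually_filtermap)
  next
    fix y assume "y \<in> elts (pt F (f \<circ> k))"
    then obtain g where g: "y = pt F g" "\<forall>\<^sub>F x in F. g x \<in> elts (f (k x))"
      by (auto simp: elts_pt [OF F])
    have eq: "\<forall>\<^sub>F x in F. g x = ((g \<circ> k') \<circ> k) x"
      by (rule eventually_mono [OF k]) simp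
    have "\<forall>\<^sub>F x in F. (g \<circ> k') (k x) \<in> elts (f (k x))"
      using g(2) k by eventually_elim simp
    moreover from this have "pt (filtermap k F) (g \<circ> k') = y"
      using 1 [of "g \<circ> k'"] pt_cong [OF F eq] g(1) by (simp add: eventually_filtermap o_def)
    ultimately show "y \<in> elts (pt (filtermap k F) f)"
      by (auto simp: elts_pt [OF K] eventually_filtermap)
  qed
qed

text \<open>Collapsing along the sum is collapsing in the fibres and then along \<open>F\<close>; so
  the sum computes the ultrapower, inside the one by \<open>F\<close>, by the ultrafilter that
  \<open>G\<close> represents.\<close>

lemma pt_dsum:
  fixes f :: "'a \<times> 'b \<Rightarrow> 'v::zfc"
  assumes F: "ccuf TYPE('v) F" and G: "\<forall>\<^sub>F x in F. ccuf TYPE('v) (G x)"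
  shows "pt (dsum F G) f = pt F (\<lambda>x. pt (G x) (\<lambda>y. f (x, y)))"
proof (induction f rule: wf_induct_rule [OF wf_ult [OF ccuf_dsum [OF F G]]])
  case (1 f)
  note FG = ccuf_dsum [OF F G]
  have mem: "(\<forall>\<^sub>F x in F. pt (G x) (\<lambda>y. g (x, y)) \<in> elts (pt (G x) (\<lambda>y. f (x, y)))) \<longleftrightarrow>
      (\<forall>\<^sub>F p in dsum F G. g p \<in> elts (f p))" for g
    unfolding eventually_dsum
    by (rule eventually_subst, rule eventually_mono [OF G]) (simp add: pt_mem_iff)
  show ?case
  proof (rule extensionality, intro equalityI subsetI)
    fix y assume "y \<in> elts (pt (dsum F G) f)"
    then obtain g where g: "y = pt (dsum F G) g" "\<forall>\<^sub>F x in dsum F G. g x \<in> elts (f x)"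
      by (auto simp: elts_pt [OF FG])
    then show "y \<in> elts (pt F (\<lambda>x. pt (G x) (\<lambda>y. f (x, y))))"
      using 1 [of g] mem [of g] by (simp add: pt_mem_iff [OF F])
  next
    fix y assume "y \<in> elts (pt F (\<lambda>x. pt (G x) (\<lambda>y. f (x, y))))"
    then obtain h where h: "y = pt F h" "\<forall>\<^sub>F x in F. h x \<in> elts (pt (G x) (\<lambda>y. f (x, y)))"
      by (auto simp: elts_pt [OF F])
    \<comment> \<open>An element of a point is a point, so \<open>h x\<close> has a representing
      function in almost every fibre; these are chosen and uncurried to one function on the
      sum.\<close>
    have "\<forall>\<^sub>F x in F. \<exists>g. h x = pt (G x) g"
      using h(2) G by eventually_elim (auto simp: elts_pt)
    then obtain g where g: "\<forall>\<^sub>F x in F. h x = pt (G x) (g x)"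
      unfolding eventually_ex_iff by blast
    define g' where "g' = (\<lambda>(x, y). g x y)"
    have g': "\<forall>\<^sub>F x in F. h x = pt (G x) (\<lambda>y. g' (x, y))"
      using g by (simp add: g'_def)
    have "\<forall>\<^sub>F x in F. pt (G x) (\<lambda>y. g' (x, y)) \<in> elts (pt (G x) (\<lambda>y. f (x, y)))"
      using h(2) g' by eventually_elim simp
    then have m: "\<forall>\<^sub>F p in dsum F G. g' p \<in> elts (f p)" by (simp add: mem)
    then have "y = pt (dsum F G) g'"
      using 1 [of g'] pt_cong [OF F g'] h(1) by simp
    then show "y \<in> elts (pt (dsum F G) f)"
      using m by (auto simp: elts_pt [OF FG])
  qed
qed

section \<open>Functions as sets\<close>

lemma elts_restrict_fun: "elts (restrict_fun h S) = (\<lambda>a. opair a (h a)) ` elts S"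
  by (simp add: restrict_fun_def)

lemma is_fun_restrict_fun: "is_fun (restrict_fun h S) S"
  by (auto simp: is_fun_def elts_restrict_fun)

lemma app_opair:
  assumes "is_fun f S" "a \<in> elts S" shows "opair a (app f a) \<in> elts f"
proof -
  have "\<exists>!y. opair a y \<in> elts f" using assms unfolding is_fun_def by blast
  then show ?thesis unfolding app_def by (rule theI')
qed

lemma app_eqI:
  assumes "is_fun f S" "a \<in> elts S" "opair a y \<in> elts f" shows "app f a = y"
proof -
  have "\<exists>!y. opair a y \<in> elts f" using assms unfolding is_fun_def by blast
  then show ?thesis unfolding app_def using assms(3) by (rule the1_equality)
qed

lemma app_restrict_fun [simp]: "a \<in> elts S \<Longrightarrow> app (restrict_fun h S) a = h a"
  by (rule app_eqI [OF is_fun_restrict_fun]) (auto simp: elts_restrict_fun)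

lemma is_fun_eq_restrict_fun:
  assumes "is_fun f S" shows "f = restrict_fun (app f) S"
proof (rule extensionality, intro equalityI subsetI)
  fix p assume p: "p \<in> elts f"
  then obtain a y where "a \<in> elts S" "p = opair a y"
    using assms unfolding is_fun_def by blast
  then show "p \<in> elts (restrict_fun (app f) S)"
    using app_eqI [OF assms] p by (auto simp: elts_restrict_fun)
qed (auto simp: elts_restrict_fun app_opair [OF assms])

lemma elts_underlying: "elts (underlying Z) = (\<Union>A\<in>elts Z. elts A)"
  unfolding underlying_def by (simp add: small_UN)

lemma underlying_eq: "ultrafilter_on M S Z \<Longrightarrow> underlying Z = S"
  unfolding ultrafilter_on_def by (rule extensionality) (auto simp: elts_underlying)

section \<open>Los' theorem for the relativized notions\<close>

context
  fixes F :: "'a filter"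
  assumes F: "ccuf TYPE('v::zfc) F"
begin

text \<open>With no syntax of formulas at hand, Los' theorem takes the form of such rules:
  \<open>Q\<close> is a predicate of points, \<open>R x\<close> the corresponding one at
  \<open>x\<close>, and a definition is transferred by one rule for each of its quantifiers.
  \<open>pt_all\<close> and \<open>pt_ex\<close> treat quantifiers over the model.\<close>

lemma pt_ball:
  fixes f :: "'a \<Rightarrow> 'v"
  assumes "\<And>g. \<forall>\<^sub>F x in F. g x \<in> elts (f x) \<Longrightarrow> Q (pt F g) \<longleftrightarrow> (\<forall>\<^sub>F x in F. R x (g x))"
  shows "(\<forall>y\<in>elts (pt F f). Q y) \<longleftrightarrow> (\<forall>\<^sub>F x in F. \<forall>y\<in>elts (f x). R x y)"
proof -
  have "(\<forall>y\<in>elts (pt F f). Q y) \<longleftrightarrow>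
      (\<forall>g. (\<forall>\<^sub>F x in F. g x \<in> elts (f x)) \<longrightarrow> (\<forall>\<^sub>F x in F. R x (g x)))"
    using assms by (auto simp: elts_pt [OF F])
  also have "\<dots> \<longleftrightarrow> (\<forall>\<^sub>F x in F. \<forall>y\<in>elts (f x). R x y)"
    by (simp add: Ball_def eventually_all_iff [OF F] eventually_imp [OF F])
  finally show ?thesis .
qed

lemma pt_bex:
  fixes f :: "'a \<Rightarrow> 'v"
  assumes "\<And>g. \<forall>\<^sub>F x in F. g x \<in> elts (f x) \<Longrightarrow> Q (pt F g) \<longleftrightarrow> (\<forall>\<^sub>F x in F. R x (g x))"
  shows "(\<exists>y\<in>elts (pt F f). Q y) \<longleftrightarrow> (\<forall>\<^sub>F x in F. \<exists>y\<in>elts (f x). R x y)"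
proof -
  have "(\<exists>y\<in>elts (pt F f). Q y) \<longleftrightarrow>
      (\<exists>g. (\<forall>\<^sub>F x in F. g x \<in> elts (f x)) \<and> (\<forall>\<^sub>F x in F. R x (g x)))"
    using assms by (auto simp: elts_pt [OF F])
  also have "\<dots> \<longleftrightarrow> (\<forall>\<^sub>F x in F. \<exists>y\<in>elts (f x). R x y)"
    by (simp add: Bex_def eventually_ex_iff eventually_conj_iff)
  finally show ?thesis .
qed

lemma pt_all:
  assumes "\<And>g :: 'a \<Rightarrow> 'v. Q (pt F g) \<longleftrightarrow> (\<forall>\<^sub>F x in F. R x (g x))"
  shows "(\<forall>y\<in>range (pt F). Q y) \<longleftrightarrow> (\<forall>\<^sub>F x in F. \<forall>y. R x y)"
  using assms by (simp add: eventually_all_iff [OF F])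

lemma pt_ex:
  assumes "\<And>g :: 'a \<Rightarrow> 'v. Q (pt F g) \<longleftrightarrow> (\<forall>\<^sub>F x in F. R x (g x))"
  shows "(\<exists>y\<in>range (pt F). Q y) \<longleftrightarrow> (\<forall>\<^sub>F x in F. \<exists>y. R x y)"
  using assms by (simp add: eventually_ex_iff)

lemma pt_subset:
  fixes f g :: "'a \<Rightarrow> 'v"
  shows "elts (pt F f) \<subseteq> elts (pt F g) \<longleftrightarrow> (\<forall>\<^sub>F x in F. elts (f x) \<subseteq> elts (g x))"
  unfolding subset_iff Ball_def [symmetric] by (rule pt_ball) (simp add: pt_mem_iff [OF F])

lemma pt_empty: "pt F (\<lambda>_. set_of {} :: 'v) = set_of {}"
  by (rule pt_eqI [OF F]) (simp_all add: eventually_const_iff [OF F])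

lemma pt_pair:
  fixes f g :: "'a \<Rightarrow> 'v"
  shows "set_of {pt F f, pt F g} = pt F (\<lambda>x. set_of {f x, g x})"
  by (rule sym, rule pt_eqI [OF F]) (auto simp: pt_eq_iff [OF F] eventually_disj [OF F])

lemma pt_opair:
  fixes f g :: "'a \<Rightarrow> 'v"
  shows "opair (pt F f) (pt F g) = pt F (\<lambda>x. opair (f x) (g x))"
  using pt_pair [of f f] by (simp add: opair_def pt_pair)

lemma opair_in_range: "opair a (y :: 'v) \<in> range (pt F) \<Longrightarrow> y \<in> range (pt F)"
proof -
  assume "opair a y \<in> range (pt F)"
  then have "set_of {a, y} \<in> range (pt F)"
    by (rule range_pt_transitive [OF F, rotated]) (simp add: elts_opair)
  then show ?thesis
    by (rule range_pt_transitive [OF F, rotated]) simp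
qed

lemma pt_Collect:
  fixes f :: "'a \<Rightarrow> 'v"
  assumes "\<And>g. \<forall>\<^sub>F x in F. g x \<in> elts (f x) \<Longrightarrow> Q (pt F g) \<longleftrightarrow> (\<forall>\<^sub>F x in F. R x (g x))"
  shows "set_of {y \<in> elts (pt F f). Q y} = pt F (\<lambda>x. set_of {y \<in> elts (f x). R x y})"
proof (rule sym, rule pt_eqI [OF F])
  show "elts (set_of {y \<in> elts (pt F f). Q y}) \<subseteq> range (pt F)"
    by (auto elim: mem_ptE [OF F])
  show "pt F g \<in> elts (set_of {y \<in> elts (pt F f). Q y}) \<longleftrightarrow>
      (\<forall>\<^sub>F x in F. g x \<in> elts (set_of {y \<in> elts (f x). R x y}))" for g
    using assms [of g] by (auto simp: pt_mem_iff [OF F] eventually_conj_iff)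
qed

lemma pt_Int:
  fixes f g :: "'a \<Rightarrow> 'v"
  shows "set_of (elts (pt F f) \<inter> elts (pt F g)) = pt F (\<lambda>x. set_of (elts (f x) \<inter> elts (g x)))"
  unfolding Int_def by (rule pt_Collect) (simp add: pt_mem_iff [OF F])

lemma pt_Diff:
  fixes f g :: "'a \<Rightarrow> 'v"
  shows "set_of (elts (pt F f) - elts (pt F g)) = pt F (\<lambda>x. set_of (elts (f x) - elts (g x)))"
  unfolding set_diff_eq
  by (rule pt_Collect) (simp add: pt_mem_iff [OF F] eventually_not [OF F])

lemma pt_underlying:
  fixes f :: "'a \<Rightarrow> 'v"
  shows "underlying (pt F f) = pt F (\<lambda>x. underlying (f x))"
proof (rule sym, rule pt_eqI [OF F])
  show "elts (underlying (pt F f)) \<subseteq> range (pt F)"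
    by (auto simp: elts_underlying elim!: mem_ptE [OF F])
  have "(\<exists>A\<in>elts (pt F f). pt F g \<in> elts A) \<longleftrightarrow> (\<forall>\<^sub>F x in F. \<exists>A\<in>elts (f x). g x \<in> elts A)" for g
    by (rule pt_bex) (simp add: pt_mem_iff [OF F])
  then show "pt F g \<in> elts (underlying (pt F f)) \<longleftrightarrow>
      (\<forall>\<^sub>F x in F. g x \<in> elts (underlying (f x)))" for g
    by (simp add: elts_underlying)
qed

lemma pt_Ord: "Ord (pt F f :: 'v) \<longleftrightarrow> (\<forall>\<^sub>F x in F. Ord (f x))"
proof -
  have "(\<forall>y\<in>elts (pt F f). elts y \<subseteq> elts (pt F f)) \<longleftrightarrow>
      (\<forall>\<^sub>F x in F. \<forall>y\<in>elts (f x). elts y \<subseteq> elts (f x))"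
    by (rule pt_ball) (simp add: pt_subset)
  moreover have "(\<forall>y\<in>elts (pt F f). \<forall>z\<in>elts y. elts z \<subseteq> elts y) \<longleftrightarrow>
      (\<forall>\<^sub>F x in F. \<forall>y\<in>elts (f x). \<forall>z\<in>elts y. elts z \<subseteq> elts y)"
    by (rule pt_ball, rule pt_ball) (simp add: pt_subset)
  ultimately show ?thesis
    by (simp add: Ord_def eventually_conj_iff)
qed

lemma pt_is_fun:
  fixes f S :: "'a \<Rightarrow> 'v"
  shows "is_fun (pt F f) (pt F S) \<longleftrightarrow> (\<forall>\<^sub>F x in F. is_fun (f x) (S x))"
proof -
  \<comment> \<open>\<open>is_fun\<close> quantifies over all values; restricting them to a class
    \<open>X\<close> that contains the actual ones changes nothing. \<open>X\<close> is the
    ultrapower for \<open>pt F f\<close> and everything for \<open>f x\<close>.\<close>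
  have is_fun_alt: "is_fun f S \<longleftrightarrow> (\<forall>p\<in>elts f. \<exists>a\<in>elts S. \<exists>y\<in>X. p = opair a y) \<and>
      (\<forall>a\<in>elts S. (\<exists>y\<in>X. opair a y \<in> elts f) \<and>
        (\<forall>y\<in>X. \<forall>y'\<in>X. opair a y \<in> elts f \<and> opair a y' \<in> elts f \<longrightarrow> y = y'))"
    if X: "\<And>a y. opair a y \<in> elts f \<Longrightarrow> y \<in> X" for f S :: 'v and X
    unfolding is_fun_def using X by (safe; metis)
  have 1: "(\<forall>p\<in>elts (pt F f). \<exists>a\<in>elts (pt F S). \<exists>y\<in>range (pt F). p = opair a y) \<longleftrightarrow>
      (\<forall>\<^sub>F x in F. \<forall>p\<in>elts (f x). \<exists>a\<in>elts (S x). \<exists>y. p = opair a y)"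
    by (rule pt_ball, rule pt_bex, rule pt_ex) (simp add: pt_opair pt_eq_iff [OF F])
  have 2: "(\<forall>a\<in>elts (pt F S). (\<exists>y\<in>range (pt F). opair a y \<in> elts (pt F f)) \<and>
        (\<forall>y\<in>range (pt F). \<forall>y'\<in>range (pt F).
           opair a y \<in> elts (pt F f) \<and> opair a y' \<in> elts (pt F f) \<longrightarrow> y = y')) \<longleftrightarrow>
     (\<forall>\<^sub>F x in F. \<forall>a\<in>elts (S x). (\<exists>y. opair a y \<in> elts (f x)) \<and>
        (\<forall>y y'. opair a y \<in> elts (f x) \<and> opair a y' \<in> elts (f x) \<longrightarrow> y = y'))"
  proof (rule pt_ball)
    fix a
    have "(\<exists>y\<in>range (pt F). opair (pt F a) y \<in> elts (pt F f)) \<longleftrightarrow>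
        (\<forall>\<^sub>F x in F. \<exists>y. opair (a x) y \<in> elts (f x))"
      by (rule pt_ex) (simp add: pt_opair pt_mem_iff [OF F])
    moreover have "(\<forall>y\<in>range (pt F). \<forall>y'\<in>range (pt F).
        opair (pt F a) y \<in> elts (pt F f) \<and> opair (pt F a) y' \<in> elts (pt F f) \<longrightarrow> y = y') \<longleftrightarrow>
        (\<forall>\<^sub>F x in F. \<forall>y y'. opair (a x) y \<in> elts (f x) \<and> opair (a x) y' \<in> elts (f x) \<longrightarrow> y = y')"
      by (rule pt_all, rule pt_all)
        (simp add: pt_opair pt_mem_iff [OF F] pt_eq_iff [OF F] eventually_imp [OF F]
          eventually_conj_iff)
    ultimately show "((\<exists>y\<in>range (pt F). opair (pt F a) y \<in> elts (pt F f)) \<and>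
        (\<forall>y\<in>range (pt F). \<forall>y'\<in>range (pt F).
           opair (pt F a) y \<in> elts (pt F f) \<and> opair (pt F a) y' \<in> elts (pt F f) \<longrightarrow> y = y')) \<longleftrightarrow>
     (\<forall>\<^sub>F x in F. (\<exists>y. opair (a x) y \<in> elts (f x)) \<and>
        (\<forall>y y'. opair (a x) y \<in> elts (f x) \<and> opair (a x) y' \<in> elts (f x) \<longrightarrow> y = y'))"
      by (simp only: eventually_conj_iff)
  qed
  have "is_fun (pt F f) (pt F S) \<longleftrightarrow>
     (\<forall>\<^sub>F x in F. \<forall>p\<in>elts (f x). \<exists>a\<in>elts (S x). \<exists>y. p = opair a y) \<and>
     (\<forall>\<^sub>F x in F. \<forall>a\<in>elts (S x). (\<exists>y. opair a y \<in> elts (f x)) \<and>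
        (\<forall>y y'. opair a y \<in> elts (f x) \<and> opair a y' \<in> elts (f x) \<longrightarrow> y = y'))"
    unfolding 1 [symmetric] 2 [symmetric]
    by (rule is_fun_alt) (metis opair_in_range rangeI range_pt_transitive [OF F])
  also have "\<dots> \<longleftrightarrow> (\<forall>\<^sub>F x in F. is_fun (f x) (S x))"
    using is_fun_alt [where X = UNIV] by (simp add: eventually_conj_iff)
  finally show ?thesis .
qed

lemma pt_app:
  fixes f S a :: "'a \<Rightarrow> 'v"
  assumes "\<forall>\<^sub>F x in F. is_fun (f x) (S x)" "\<forall>\<^sub>F x in F. a x \<in> elts (S x)"
  shows "app (pt F f) (pt F a) = pt F (\<lambda>x. app (f x) (a x))"
proof (rule app_eqI)
  show "is_fun (pt F f) (pt F S)" using assms by (simp add: pt_is_fun)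
  show "pt F a \<in> elts (pt F S)" using assms by (simp add: pt_mem_iff [OF F])
  have "\<forall>\<^sub>F x in F. opair (a x) (app (f x) (a x)) \<in> elts (f x)"
    using assms by eventually_elim (rule app_opair)
  then show "opair (pt F a) (pt F (\<lambda>x. app (f x) (a x))) \<in> elts (pt F f)"
    by (simp add: pt_opair pt_mem_iff [OF F])
qed

lemma pt_restrict_fun:
  fixes h :: "'a \<Rightarrow> 'v \<Rightarrow> 'v"
  assumes "\<And>g. \<forall>\<^sub>F x in F. g x \<in> elts (S x) \<Longrightarrow> H (pt F g) = pt F (\<lambda>x. h x (g x))"
  shows "restrict_fun H (pt F S) = pt F (\<lambda>x. restrict_fun (h x) (S x))"
proof (rule sym, rule pt_eqI [OF F])
  show "elts (restrict_fun H (pt F S)) \<subseteq> range (pt F)"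
    using assms by (auto simp: elts_restrict_fun pt_opair elim!: mem_ptE [OF F])
  have "(\<exists>a\<in>elts (pt F S). pt F g = opair a (H a)) \<longleftrightarrow>
      (\<forall>\<^sub>F x in F. \<exists>a\<in>elts (S x). g x = opair a (h x a))" for g
    by (rule pt_bex) (simp add: assms pt_opair pt_eq_iff [OF F])
  then show "pt F g \<in> elts (restrict_fun H (pt F S)) \<longleftrightarrow>
      (\<forall>\<^sub>F x in F. g x \<in> elts (restrict_fun (h x) (S x)))" for g
    by (simp add: elts_restrict_fun image_iff)
qed

lemma pt_ord_of_nat: "pt F (\<lambda>_. ord_of_nat n :: 'v) = ord_of_nat n"
proof (induction n)
  case 0
  then show ?case using pt_empty by simp
next
  case (Suc n)
  show ?case
  proof (rule pt_eqI [OF F])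
    have "elts (ord_of_nat n :: 'v) \<subseteq> range (pt F)"
      using Suc by (metis range_pt_transitive [OF F] rangeI subsetI)
    moreover have "ord_of_nat n \<in> range (pt F :: _ \<Rightarrow> 'v)"
      using Suc by (metis rangeI)
    ultimately show "elts (ord_of_nat (Suc n) :: 'v) \<subseteq> range (pt F)"
      by (simp add: elts_ord_of_nat del: ord_of_nat.simps)
    have "pt F g \<in> elts (ord_of_nat n) \<longleftrightarrow> (\<forall>\<^sub>F x in F. g x \<in> elts (ord_of_nat n))"
      "pt F g = ord_of_nat n \<longleftrightarrow> (\<forall>\<^sub>F x in F. g x = ord_of_nat n)" for g :: "'a \<Rightarrow> 'v"
      using pt_mem_iff [OF F, of g "\<lambda>_. ord_of_nat n"] pt_eq_iff [OF F, of g "\<lambda>_. ord_of_nat n"]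
      by (simp_all only: Suc)
    then show "pt F g \<in> elts (ord_of_nat (Suc n)) \<longleftrightarrow> (\<forall>\<^sub>F x in F. g x \<in> elts (ord_of_nat (Suc n)))"
      for g :: "'a \<Rightarrow> 'v"
      by (simp add: elts_ord_of_nat eventually_disj [OF F] del: ord_of_nat.simps)
  qed
qed

text \<open>By countable completeness a function into \<open>omega\<close> is constant on a large
  set, so the ultrapower gets no new natural numbers.\<close>

lemma pt_omega: "pt F (\<lambda>_. omega :: 'v) = omega"
proof (rule pt_eqI [OF F])
  show "elts (omega :: 'v) \<subseteq> range (pt F)"
    using pt_ord_of_nat by (auto simp: elts_omega) (metis rangeI)
  fix g :: "'a \<Rightarrow> 'v"
  have "pt F g = ord_of_nat n \<longleftrightarrow> (\<forall>\<^sub>F x in F. g x = ord_of_nat n)" for n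
    using pt_eq_iff [OF F, of g "\<lambda>_. ord_of_nat n"] by (simp only: pt_ord_of_nat)
  moreover have "(\<exists>n. \<forall>\<^sub>F x in F. g x = ord_of_nat n) \<longleftrightarrow> (\<forall>\<^sub>F x in F. \<exists>n. g x = ord_of_nat n)"
    using eventually_countable [OF F, of "\<lambda>n x. g x \<noteq> ord_of_nat n"]
      eventually_not [OF F, of "\<lambda>x. \<exists>n. g x = ord_of_nat n"]
    by (auto simp: eventually_not [OF F])
  ultimately show "pt F g \<in> elts omega \<longleftrightarrow> (\<forall>\<^sub>F x in F. g x \<in> elts omega)"
    by (simp add: elts_omega image_iff)
qed

lemma pt_ultrafilter_on:
  fixes S Z :: "'a \<Rightarrow> 'v"
  shows "ultrafilter_on (range (pt F)) (pt F S) (pt F Z) \<longleftrightarrow>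
    (\<forall>\<^sub>F x in F. ultrafilter_on UNIV (S x) (Z x))"
proof -
  let ?Z = "pt F Z" and ?S = "pt F S"
  have 1: "(\<forall>A\<in>elts ?Z. elts A \<subseteq> elts ?S) \<longleftrightarrow> (\<forall>\<^sub>F x in F. \<forall>A\<in>elts (Z x). elts A \<subseteq> elts (S x))"
    by (rule pt_ball) (simp add: pt_subset)
  have 2: "set_of {} \<notin> elts ?Z \<longleftrightarrow> (\<forall>\<^sub>F x in F. set_of {} \<notin> elts (Z x))"
    using pt_mem_iff [OF F, of "\<lambda>_. set_of {}" Z] by (simp add: pt_empty eventually_not [OF F])
  have 3: "(\<forall>A\<in>elts ?Z. \<forall>B\<in>elts ?Z. set_of (elts A \<inter> elts B) \<in> elts ?Z) \<longleftrightarrow>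
      (\<forall>\<^sub>F x in F. \<forall>A\<in>elts (Z x). \<forall>B\<in>elts (Z x). set_of (elts A \<inter> elts B) \<in> elts (Z x))"
    by (rule pt_ball, rule pt_ball) (simp add: pt_Int pt_mem_iff [OF F])
  have 4: "(\<forall>A\<in>elts ?Z. \<forall>B\<in>range (pt F). elts A \<subseteq> elts B \<and> elts B \<subseteq> elts ?S \<longrightarrow> B \<in> elts ?Z) \<longleftrightarrow>
      (\<forall>\<^sub>F x in F. \<forall>A\<in>elts (Z x). \<forall>B. elts A \<subseteq> elts B \<and> elts B \<subseteq> elts (S x) \<longrightarrow> B \<in> elts (Z x))"
    by (rule pt_ball, rule pt_all)
      (simp add: pt_subset pt_mem_iff [OF F] eventually_imp [OF F] eventually_conj_iff)
  have 5: "(\<forall>A\<in>range (pt F). elts A \<subseteq> elts ?S \<longrightarrow> A \<in> elts ?Z \<or> set_of (elts ?S - elts A) \<in> elts ?Z) \<longleftrightarrow>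
      (\<forall>\<^sub>F x in F. \<forall>A. elts A \<subseteq> elts (S x) \<longrightarrow> A \<in> elts (Z x) \<or> set_of (elts (S x) - elts A) \<in> elts (Z x))"
    by (rule pt_all)
      (simp add: pt_subset pt_Diff pt_mem_iff [OF F] eventually_imp [OF F] eventually_disj [OF F])
  show ?thesis
    unfolding ultrafilter_on_def 1 2 3 4 5 by (simp add: eventually_conj_iff pt_mem_iff [OF F])
qed

lemma pt_countably_complete_on:
  fixes S Z :: "'a \<Rightarrow> 'v"
  shows "countably_complete_on (range (pt F)) (pt F S) (pt F Z) \<longleftrightarrow>
    (\<forall>\<^sub>F x in F. countably_complete_on UNIV (S x) (Z x))"
  unfolding countably_complete_on_def ball_UNIV
proof (rule pt_all)
  fix f :: "'a \<Rightarrow> 'v"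
  show "(is_fun (pt F f) omega \<and> (\<forall>n\<in>elts omega. app (pt F f) n \<in> elts (pt F Z)) \<longrightarrow>
      set_of {a \<in> elts (pt F S). \<forall>n\<in>elts omega. a \<in> elts (app (pt F f) n)} \<in> elts (pt F Z)) \<longleftrightarrow>
    (\<forall>\<^sub>F x in F. is_fun (f x) omega \<and> (\<forall>n\<in>elts omega. app (f x) n \<in> elts (Z x)) \<longrightarrow>
      set_of {a \<in> elts (S x). \<forall>n\<in>elts omega. a \<in> elts (app (f x) n)} \<in> elts (Z x))"
  \<comment> \<open>\<open>pt_app\<close> presupposes functions; in the other case both sides hold
    vacuously.\<close>
  proof (cases "\<forall>\<^sub>F x in F. is_fun (f x) omega")
    case True
    have app: "app (pt F f) (pt F n) = pt F (\<lambda>x. app (f x) (n x))"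
      if "\<forall>\<^sub>F x in F. n x \<in> elts omega" for n
      using that True by (intro pt_app)
    have ball: "(\<forall>n\<in>elts omega. Q n) \<longleftrightarrow> (\<forall>\<^sub>F x in F. \<forall>n\<in>elts omega. R x n)"
      if "\<And>n. \<forall>\<^sub>F x in F. n x \<in> elts omega \<Longrightarrow> Q (pt F n) \<longleftrightarrow> (\<forall>\<^sub>F x in F. R x (n x))"
      for Q :: "'v \<Rightarrow> bool" and R
      using pt_ball [of "\<lambda>_. omega" Q R] that by (simp add: pt_omega)
    have 1: "(\<forall>n\<in>elts omega. app (pt F f) n \<in> elts (pt F Z)) \<longleftrightarrow>
        (\<forall>\<^sub>F x in F. \<forall>n\<in>elts omega. app (f x) n \<in> elts (Z x))"
      by (rule ball) (simp add: app pt_mem_iff [OF F])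
    have 2: "set_of {a \<in> elts (pt F S). \<forall>n\<in>elts omega. a \<in> elts (app (pt F f) n)} =
        pt F (\<lambda>x. set_of {a \<in> elts (S x). \<forall>n\<in>elts omega. a \<in> elts (app (f x) n)})"
      by (rule pt_Collect, rule ball) (simp add: app pt_mem_iff [OF F])
    have "is_fun (pt F f) omega"
      using True pt_is_fun [of f "\<lambda>_. omega"] by (simp add: pt_omega)
    then show ?thesis
      using True
      unfolding 1 2 by (simp add: pt_mem_iff [OF F] eventually_imp [OF F] eventually_conj_iff)
  next
    case False
    then have "\<not> is_fun (pt F f) omega"
      using pt_is_fun [of f "\<lambda>_. omega"] by (simp add: pt_omega)
    then show ?thesis using False by (simp add: eventually_imp [OF F] eventually_conj_iff)
  qed
qed

lemma pt_cc_ultrafilter: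
  fixes Z :: "'a \<Rightarrow> 'v"
  shows "cc_ultrafilter (range (pt F)) (pt F Z) \<longleftrightarrow> (\<forall>\<^sub>F x in F. cc_ultrafilter UNIV (Z x))"
proof -
  have "cc_ultrafilter (range (pt F)) (pt F Z) \<longleftrightarrow> (\<exists>S\<in>range (pt F).
      ultrafilter_on (range (pt F)) S (pt F Z) \<and> countably_complete_on (range (pt F)) S (pt F Z))"
    unfolding cc_ultrafilter_def by (auto simp: ultrafilter_on_def)
  also have "\<dots> \<longleftrightarrow> (\<forall>\<^sub>F x in F. \<exists>S. ultrafilter_on UNIV S (Z x) \<and> countably_complete_on UNIV S (Z x))"
    by (rule pt_ex) (simp add: pt_ultrafilter_on pt_countably_complete_on eventually_conj_iff)
  finally show ?thesis by (simp add: cc_ultrafilter_def)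
qed

end

section \<open>Ultrapowers of ultrapowers\<close>

definition filt :: "'v::zfc \<Rightarrow> 'v filter" where
  "filt Z = Abs_filter (\<lambda>P. set_of {a \<in> elts (underlying Z). P a} \<in> elts Z)"

lemma cc_ultrafilterD:
  assumes "cc_ultrafilter M Z"
  shows "ultrafilter_on M (underlying Z) Z" "countably_complete_on M (underlying Z) Z"
  using assms underlying_eq unfolding cc_ultrafilter_def by blast+

context
  fixes Z :: "'v::zfc"
  assumes Z: "cc_ultrafilter UNIV Z"
begin

lemma eventually_filt: "eventually P (filt Z) \<longleftrightarrow> set_of {a \<in> elts (underlying Z). P a} \<in> elts Z"
  unfolding filt_def
proof (rule eventually_Abs_filter, rule is_filter.intro)
  note u = cc_ultrafilterD(1) [OF Z, unfolded ultrafilter_on_def]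
  show "set_of {a \<in> elts (underlying Z). True} \<in> elts Z"
    using u by simp
  show "set_of {a \<in> elts (underlying Z). P a \<and> Q a} \<in> elts Z"
    if "set_of {a \<in> elts (underlying Z). P a} \<in> elts Z"
      "set_of {a \<in> elts (underlying Z). Q a} \<in> elts Z" for P Q
  proof -
    have "set_of (elts (set_of {a \<in> elts (underlying Z). P a}) \<inter>
        elts (set_of {a \<in> elts (underlying Z). Q a})) \<in> elts Z"
      using u that by blast
    moreover have "{a \<in> elts (underlying Z). P a} \<inter> {a \<in> elts (underlying Z). Q a} =
        {a \<in> elts (underlying Z). P a \<and> Q a}" by blast
    ultimately show ?thesis by simp
  qed
  show "set_of {a \<in> elts (underlying Z). Q a} \<in> elts Z"
    if "\<forall>x. P x \<longrightarrow> Q x" "set_of {a \<in> elts (underlying Z). P a} \<in> elts Z" for P Q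
  proof -
    have "elts (set_of {a \<in> elts (underlying Z). P a}) \<subseteq> elts (set_of {a \<in> elts (underlying Z). Q a})"
      "elts (set_of {a \<in> elts (underlying Z). Q a}) \<subseteq> elts (underlying Z)"
      using that(1) by auto
    then show ?thesis using u that(2) by blast
  qed
qed

lemma eventually_filt_underlying: "\<forall>\<^sub>F a in filt Z. a \<in> elts (underlying Z)"
  using cc_ultrafilterD(1) [OF Z] by (simp add: eventually_filt ultrafilter_on_def)

lemma ccuf_filt: "ccuf TYPE('v) (filt Z)"
  unfolding ccuf_def
proof (intro conjI allI impI)
  note u = cc_ultrafilterD(1) [OF Z, unfolded ultrafilter_on_def]
  show "filt Z \<noteq> bot"
    using eventually_filt [of "\<lambda>_. False"] u by auto
  show "eventually P (filt Z) \<or> (\<forall>\<^sub>F x in filt Z. \<not> P x)" for P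
  proof -
    have "set_of {a \<in> elts (underlying Z). P a} \<in> elts Z \<or>
       set_of (elts (underlying Z) - elts (set_of {a \<in> elts (underlying Z). P a})) \<in> elts Z"
    proof -
      have "elts (set_of {a \<in> elts (underlying Z). P a}) \<subseteq> elts (underlying Z)" by auto
      then show ?thesis using u by blast
    qed
    moreover have "elts (underlying Z) - {a \<in> elts (underlying Z). P a} =
        {a \<in> elts (underlying Z). \<not> P a}" by blast
    ultimately show ?thesis by (simp add: eventually_filt)
  qed
  show "\<forall>\<^sub>F x in filt Z. \<forall>n. P n x" if P: "\<forall>n. eventually (P n) (filt Z)" for P :: "nat \<Rightarrow> _"
  proof -
    \<comment> \<open>Countable completeness of \<open>Z\<close> speaks of sequences that are sets,
      so the sequence of predicates is coded as a function on \<open>omega\<close>.\<close>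
    define f where "f = restrict_fun
        (\<lambda>m. set_of {a \<in> elts (underlying Z). P (inv ord_of_nat m) a}) omega"
    have f: "app f (ord_of_nat n) = set_of {a \<in> elts (underlying Z). P n a}" for n
      unfolding f_def by (simp add: elts_omega inj_ord_of_nat)
    have "\<forall>n\<in>elts omega. app f n \<in> elts Z"
      using P by (auto simp: elts_omega f eventually_filt)
    moreover have "is_fun f omega" unfolding f_def by (rule is_fun_restrict_fun)
    ultimately have "set_of {a \<in> elts (underlying Z). \<forall>n\<in>elts omega. a \<in> elts (app f n)} \<in> elts Z"
      using cc_ultrafilterD(2) [OF Z] unfolding countably_complete_on_def by blast
    moreover have "{a \<in> elts (underlying Z). \<forall>n\<in>elts omega. a \<in> elts (app f n)} =
        {a \<in> elts (underlying Z). \<forall>n. P n a}"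
      by (auto simp: elts_omega f)
    ultimately show ?thesis by (simp add: eventually_filt)
  qed
  show "\<exists>A. vsmall TYPE('v) A \<and> (\<forall>\<^sub>F x in filt Z. x \<in> A)"
    using eventually_filt_underlying vsmall_iff_small small_elts by blast
qed

end

abbreviation dsum_filt :: "'a filter \<Rightarrow> ('a \<Rightarrow> 'v::zfc) \<Rightarrow> ('a \<times> 'v) filter" where
  "dsum_filt F Z \<equiv> dsum F (\<lambda>x. filt (Z x))"

abbreviation ult_rep :: "'a filter \<Rightarrow> ('a \<Rightarrow> 'v::zfc) \<Rightarrow> ('a \<Rightarrow> 'v \<Rightarrow> 'v) \<Rightarrow> 'v" where
  "ult_rep F Z h \<equiv> pt F (\<lambda>x. restrict_fun (h x) (underlying (Z x)))"

context
  fixes F :: "'a filter" and Z :: "'a \<Rightarrow> 'v::zfc"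
  assumes F: "ccuf TYPE('v::zfc) F" and Z: "\<forall>\<^sub>F x in F. cc_ultrafilter UNIV (Z x)"
begin

lemma ccuf_dsum_filt: "ccuf TYPE('v) (dsum_filt F Z)"
  by (rule ccuf_dsum [OF F], rule eventually_mono [OF Z], rule ccuf_filt)

lemma ult_funs_range_pt: "ult_funs (range (pt F)) (pt F Z) = range (ult_rep F Z)"
proof (intro equalityI subsetI)
  fix p assume "p \<in> ult_funs (range (pt F)) (pt F Z)"
  then obtain f where f: "p = pt F f" "is_fun (pt F f) (pt F (\<lambda>x. underlying (Z x)))"
    by (auto simp: ult_funs_def pt_underlying [OF F])
  have "\<forall>\<^sub>F x in F. is_fun (f x) (underlying (Z x))"
    using f(2) by (simp add: pt_is_fun [OF F])
  then have "\<forall>\<^sub>F x in F. f x = restrict_fun (app (f x)) (underlying (Z x))"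
    by (rule eventually_mono) (rule is_fun_eq_restrict_fun)
  then have "p = ult_rep F Z (\<lambda>x. app (f x))"
    unfolding f(1) by (rule pt_cong [OF F])
  then show "p \<in> range (ult_rep F Z)" by (intro range_eqI)
next
  fix p assume "p \<in> range (ult_rep F Z)"
  then show "p \<in> ult_funs (range (pt F)) (pt F Z)"
    by (auto simp: ult_funs_def pt_underlying [OF F] pt_is_fun [OF F] is_fun_restrict_fun)
qed

lemma rep_mem_ult_mem:
  "(ult_rep F Z g, ult_rep F Z f) \<in> ult_mem (range (pt F)) (pt F Z) \<longleftrightarrow> (\<forall>\<^sub>F p in dsum_filt F Z. (\<lambda>(x, y). g x y) p \<in> elts ((\<lambda>(x, y). f x y) p))"
proof -
  have app: "app (ult_rep F Z h) (pt F a) = pt F (\<lambda>x. app (restrict_fun (h x) (underlying (Z x))) (a x))"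
    if "\<forall>\<^sub>F x in F. a x \<in> elts (underlying (Z x))" for h a
    using that by (intro pt_app [OF F, where S = "\<lambda>x. underlying (Z x)"])
      (simp_all add: is_fun_restrict_fun)
  have "set_of {a \<in> elts (underlying (pt F Z)). app (ult_rep F Z g) a \<in> elts (app (ult_rep F Z f) a)} =
      pt F (\<lambda>x. set_of {a \<in> elts (underlying (Z x)).
        app (restrict_fun (g x) (underlying (Z x))) a \<in> elts (app (restrict_fun (f x) (underlying (Z x))) a)})"
    unfolding pt_underlying [OF F]
    by (rule pt_Collect [OF F]) (simp add: app pt_mem_iff [OF F])
  also have "\<dots> = pt F (\<lambda>x. set_of {a \<in> elts (underlying (Z x)). g x a \<in> elts (f x a)})"
    by (simp cong: conj_cong)
  finally have "(ult_rep F Z g, ult_rep F Z f) \<in> ult_mem (range (pt F)) (pt F Z) \<longleftrightarrow>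
      (\<forall>\<^sub>F x in F. set_of {a \<in> elts (underlying (Z x)). g x a \<in> elts (f x a)} \<in> elts (Z x))"
    by (simp add: ult_mem_def ult_funs_range_pt pt_mem_iff [OF F])
  also have "\<dots> \<longleftrightarrow> (\<forall>\<^sub>F p in dsum_filt F Z. (\<lambda>(x, y). g x y) p \<in> elts ((\<lambda>(x, y). f x y) p))"
    unfolding eventually_dsum split_conv
    by (rule eventually_subst, rule eventually_mono [OF Z]) (simp add: eventually_filt)
  finally show ?thesis .
qed

text \<open>Needed before \<open>wfrec\<close> can be unfolded in \<open>ult_point_rep\<close>. Each
  function of the model gets a chosen representing family; uncurried, the families follow the
  well-founded relation of the sum.\<close>

lemma wf_ult_mem: "wf (ult_mem (range (pt F)) (pt F Z))"
proof -
  define h where "h p = (SOME h. p = ult_rep F Z h)" for p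
  have h: "p = ult_rep F Z (h p)" if "p \<in> ult_funs (range (pt F)) (pt F Z)" for p
  proof -
    have "\<exists>h. p = ult_rep F Z h" using that by (auto simp: ult_funs_range_pt)
    then show ?thesis unfolding h_def by (rule someI_ex)
  qed
  have "ult_mem (range (pt F)) (pt F Z) \<subseteq>
      inv_image {(g, f). \<forall>\<^sub>F p in dsum_filt F Z. g p \<in> elts (f p)} (\<lambda>p. \<lambda>(x, y). h p x y)"
  proof clarify
    fix p q assume pq: "(p, q) \<in> ult_mem (range (pt F)) (pt F Z)"
    then have "p = ult_rep F Z (h p)" "q = ult_rep F Z (h q)" by (auto simp: ult_mem_def intro!: h)
    with pq have "(ult_rep F Z (h p), ult_rep F Z (h q)) \<in> ult_mem (range (pt F)) (pt F Z)" by simp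
    then show "(p, q) \<in> inv_image {(g, f). \<forall>\<^sub>F p in dsum_filt F Z. g p \<in> elts (f p)} (\<lambda>p. \<lambda>(x, y). h p x y)"
      by (simp only: rep_mem_ult_mem) simp
  qed
  then show ?thesis
    using wf_subset wf_inv_image wf_ult [OF ccuf_dsum_filt] by blast
qed

text \<open>The bridge from the relativized definitions to filters: the collapse computed in
  \<open>range (pt F)\<close> is the collapse by the sum. \<open>ultrapower_range_pt\<close> and
  \<open>ult_emb_pt\<close> follow from it.\<close>

lemma ult_point_rep:
  "ult_point (range (pt F)) (pt F Z) (ult_rep F Z (\<lambda>x y. f (x, y))) = pt (dsum_filt F Z) f"
proof (induction f rule: wf_induct_rule [OF wf_ult [OF ccuf_dsum_filt]])
  case (1 f)
  let ?R = "ult_mem (range (pt F)) (pt F Z)"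
  let ?f = "ult_rep F Z (\<lambda>x y. f (x, y))"
  have R: "{g. (g, ?f) \<in> ?R} = (\<lambda>g. ult_rep F Z (\<lambda>x y. g (x, y))) ` {g. \<forall>\<^sub>F p in dsum_filt F Z. g p \<in> elts (f p)}"
  proof (intro equalityI subsetI)
    fix q assume "q \<in> {g. (g, ?f) \<in> ?R}"
    moreover then obtain g where g: "q = ult_rep F Z g"
      by (auto simp: ult_mem_def ult_funs_range_pt)
    ultimately have "\<forall>\<^sub>F p in dsum_filt F Z. (\<lambda>(x, y). g x y) p \<in> elts (f p)"
      using rep_mem_ult_mem [of g "\<lambda>x y. f (x, y)"] by simp
    then show "q \<in> (\<lambda>g. ult_rep F Z (\<lambda>x y. g (x, y))) ` {g. \<forall>\<^sub>F p in dsum_filt F Z. g p \<in> elts (f p)}"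
      using g by (intro image_eqI [where x = "\<lambda>(x, y). g x y"]) simp_all
  next
    fix q assume "q \<in> (\<lambda>g. ult_rep F Z (\<lambda>x y. g (x, y))) ` {g. \<forall>\<^sub>F p in dsum_filt F Z. g p \<in> elts (f p)}"
    then show "q \<in> {g. (g, ?f) \<in> ?R}"
      using rep_mem_ult_mem [of "\<lambda>x y. _ (x, y)" "\<lambda>x y. f (x, y)"] by auto
  qed
  have "ult_point (range (pt F)) (pt F Z) ?f =
      set_of (cut (ult_point (range (pt F)) (pt F Z)) ?R ?f ` {g. (g, ?f) \<in> ?R})"
    unfolding ult_point_def by (subst wfrec [OF wf_ult_mem]) simp
  also have "cut (ult_point (range (pt F)) (pt F Z)) ?R ?f ` {g. (g, ?f) \<in> ?R}
      = ult_point (range (pt F)) (pt F Z) ` {g. (g, ?f) \<in> ?R}"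
    by (rule image_cong) (simp_all add: cut_apply)
  also have "\<dots> = pt (dsum_filt F Z) ` {g. \<forall>\<^sub>F p in dsum_filt F Z. g p \<in> elts (f p)}"
    unfolding R image_image by (rule image_cong) (use 1 in simp_all)
  finally show ?case
    by (subst pt_unfold [OF ccuf_dsum_filt]) simp
qed

lemma ultrapower_range_pt: "ultrapower (range (pt F)) (pt F Z) = range (pt (dsum_filt F Z))"
proof -
  have "range (ult_rep F Z) = range (\<lambda>f. ult_rep F Z (\<lambda>x y. f (x, y)))"
  proof (intro equalityI subsetI)
    fix p assume "p \<in> range (ult_rep F Z)"
    then obtain h where "p = ult_rep F Z (\<lambda>x y. (case_prod h) (x, y))" by auto
    then show "p \<in> range (\<lambda>f. ult_rep F Z (\<lambda>x y. f (x, y)))" by (intro range_eqI)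
  qed auto
  then show ?thesis
    by (simp add: ultrapower_def ult_funs_range_pt image_image ult_point_rep)
qed

lemma ult_emb_pt: "ult_emb (range (pt F)) (pt F Z) (pt F f) = pt (dsum_filt F Z) (\<lambda>(x, y). f x)"
proof -
  have "restrict_fun (\<lambda>_. pt F f) (pt F (\<lambda>x. underlying (Z x))) = ult_rep F Z (\<lambda>x _. f x)"
    by (rule pt_restrict_fun [OF F]) simp
  then show ?thesis
    using ult_point_rep [of "\<lambda>(x, y). f x"] by (simp add: ult_emb_def pt_underlying [OF F])
qed

end

text \<open>
  The universe is its own ultrapower by a principal ultrafilter, which makes the unrelativized
  notions an instance of the preceding lemmas.
\<close>

lemma ccuf_principal_unit: "ccuf TYPE('v::zfc) (principal {()})"
proof -
  have "vsmall TYPE('v) {()}"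
    unfolding vsmall_def by (rule exI [of _ "set_of {set_of {}}"], rule exI [of _ "\<lambda>_. ()"]) simp
  then show ?thesis
    unfolding ccuf_def eventually_principal
    by (auto simp: principal_eq_bot_iff intro!: exI [of _ "{()}"])
qed

lemma pt_principal_unit: "pt (principal {()}) (\<lambda>_. x :: 'v::zfc) = x"
proof (induction x rule: wf_induct_rule [OF wf_elts])
  case (1 x)
  have fn: "f = (\<lambda>_. f ())" for f :: "unit \<Rightarrow> 'v" by (rule ext) simp
  show ?case
  proof (rule extensionality, intro equalityI subsetI)
    fix y assume "y \<in> elts (pt (principal {()}) (\<lambda>_. x))"
    then obtain g where g: "y = pt (principal {()}) g" "g () \<in> elts x"
      by (auto simp: elts_pt [OF ccuf_principal_unit] eventually_principal)
    then show "y \<in> elts x" using 1 [of "g ()"] fn [of g] by simp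
  next
    fix y assume "y \<in> elts x"
    then show "y \<in> elts (pt (principal {()}) (\<lambda>_. x))"
      using 1 [of y] by (auto simp: elts_pt [OF ccuf_principal_unit] eventually_principal
          intro!: exI [of _ "\<lambda>_. y"])
  qed
qed

lemma range_pt_principal_unit: "range (pt (principal {()})) = (UNIV :: 'v::zfc set)"
proof -
  have "x \<in> range (pt (principal {()}))" for x :: 'v
    using pt_principal_unit [of x] by (metis rangeI)
  then show ?thesis by auto
qed

context
  fixes Z :: "'v::zfc"
  assumes Z: "cc_ultrafilter UNIV Z"
begin

lemma pt_dsum_unit:
  fixes f :: "unit \<times> 'v \<Rightarrow> 'v"
  shows "pt (dsum (principal {()}) (\<lambda>_. filt Z)) f = pt (filt Z) (\<lambda>y. f ((), y))"
  using pt_dsum [OF ccuf_principal_unit, of "\<lambda>_. filt Z" f] ccuf_filt [OF Z]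
  by (simp add: pt_principal_unit del: unit_abs_eta_conv)

lemma ultrapower_UNIV: "ultrapower UNIV Z = range (pt (filt Z))"
proof -
  have "ultrapower UNIV Z = range (\<lambda>f. pt (filt Z) (\<lambda>y. f ((), y)))"
    using ultrapower_range_pt [OF ccuf_principal_unit, of "\<lambda>_. Z"] Z
    by (simp add: pt_principal_unit range_pt_principal_unit pt_dsum_unit [abs_def])
  also have "\<dots> = range (pt (filt Z))"
  proof (intro equalityI subsetI)
    fix p assume "p \<in> range (pt (filt Z))"
    then obtain f where "p = pt (filt Z) (\<lambda>y. (f \<circ> snd) ((), y))" by (auto simp: o_def)
    then show "p \<in> range (\<lambda>f. pt (filt Z) (\<lambda>y. f ((), y)))" by (intro range_eqI)
  qed auto
  finally show ?thesis .
qed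

lemma ult_emb_UNIV: "ult_emb UNIV Z x = pt (filt Z) (\<lambda>_. x)"
  using ult_emb_pt [OF ccuf_principal_unit, of "\<lambda>_. Z" "\<lambda>_. x"] Z
  by (simp add: pt_principal_unit range_pt_principal_unit pt_dsum_unit)

end

text \<open>The support is injected into some set \<open>S\<close> and the ultrafilter pushed
  forward. Statements about ultrafilters that are sets thus apply to sums and products.\<close>

lemma ccuf_code:
  fixes F :: "'a filter"
  assumes F: "ccuf TYPE('v::zfc) F"
  shows "\<exists>(Z::'v) k k'. cc_ultrafilter UNIV Z \<and> filt Z = filtermap k F \<and> (\<forall>\<^sub>F x in F. k' (k x) = x)"
proof -
  obtain A where A: "vsmall TYPE('v) A" "\<forall>\<^sub>F x in F. x \<in> A"
    using F unfolding ccuf_def by blast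
  obtain S :: 'v and k' where S: "A \<subseteq> k' ` elts S"
    using A(1) unfolding vsmall_def by blast
  define k where "k x = (SOME s. s \<in> elts S \<and> k' s = x)" for x
  have k: "k x \<in> elts S" "k' (k x) = x" if "x \<in> A" for x
    unfolding k_def using someI_ex [of "\<lambda>s. s \<in> elts S \<and> k' s = x"] that S by blast+
  have kS: "\<forall>\<^sub>F x in F. k x \<in> elts S"
    by (rule eventually_mono [OF A(2)]) (rule k)
  have kk: "\<forall>\<^sub>F x in F. k' (k x) = x"
    by (rule eventually_mono [OF A(2)]) (rule k)
  define Z where "Z = set_of {B. elts B \<subseteq> elts S \<and> (\<forall>\<^sub>F x in F. k x \<in> elts B)}"
  have "small {B. elts B \<subseteq> elts S \<and> (\<forall>\<^sub>F x in F. k x \<in> elts B)}"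
    by (rule small_subset [OF small_Pow [of S]]) blast
  then have Z: "B \<in> elts Z \<longleftrightarrow> elts B \<subseteq> elts S \<and> (\<forall>\<^sub>F x in F. k x \<in> elts B)" for B
    unfolding Z_def by simp
  have u: "ultrafilter_on UNIV S Z"
    unfolding ultrafilter_on_def
  proof (intro conjI ballI impI)
    fix A B assume "A \<in> elts Z" "elts A \<subseteq> elts B \<and> elts B \<subseteq> elts S"
    then show "B \<in> elts Z" unfolding Z by (blast intro: eventually_mono)
  next
    fix B assume "elts B \<subseteq> elts S"
    then show "B \<in> elts Z \<or> set_of (elts S - elts B) \<in> elts Z"
      using kS by (auto simp: Z eventually_conj_iff eventually_not [OF F])
  qed (use kS in \<open>auto simp: Z eventually_conj_iff eventually_const_iff [OF F]\<close>)
  have c: "countably_complete_on UNIV S Z"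
    unfolding countably_complete_on_def
  proof (intro ballI impI, elim conjE)
    fix f assume "\<forall>n\<in>elts omega. app f n \<in> elts Z"
    then have "\<forall>n. \<forall>\<^sub>F x in F. k x \<in> elts (app f (ord_of_nat n))"
      by (simp add: elts_omega Z)
    then have "\<forall>\<^sub>F x in F. \<forall>n. k x \<in> elts (app f (ord_of_nat n))"
      using eventually_countable [OF F, of "\<lambda>n x. k x \<in> elts (app f (ord_of_nat n))"] by blast
    then show "set_of {a \<in> elts S. \<forall>n\<in>elts omega. a \<in> elts (app f n)} \<in> elts Z"
      using kS by (auto simp: Z elts_omega eventually_conj_iff)
  qed
  have cc: "cc_ultrafilter UNIV Z"
    using u c unfolding cc_ultrafilter_def by blast
  have "filt Z = filtermap k F"
  proof (rule filter_eqI)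
    fix P
    show "eventually P (filt Z) \<longleftrightarrow> eventually P (filtermap k F)"
      using kS by (simp add: eventually_filt [OF cc] underlying_eq [OF u] Z eventually_filtermap
          eventually_conj_iff)
  qed
  then show ?thesis using cc kk by blast
qed

section \<open>The Ultrapower Axiom for filters\<close>

lemma dsum_filtermap: "dsum (filtermap k F) G = filtermap (map_prod k id) (dsum F (\<lambda>x. G (k x)))"
  by (rule filter_eqI) (simp add: eventually_dsum eventually_filtermap)

lemma pt_dsum_filtermap:
  fixes G :: "'b \<Rightarrow> 'c filter" and F :: "'a filter"
  assumes F: "ccuf TYPE('v::zfc) F" and k: "\<forall>\<^sub>F x in F. k' (k x) = x"
    and G: "\<forall>\<^sub>F x in F. ccuf TYPE('v) (G (k x))"
  shows "pt (dsum (filtermap k F) G) f = pt (dsum F (\<lambda>x. G (k x))) (\<lambda>(x, y). f (k x, y) :: 'v)"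
proof -
  have "pt (dsum (filtermap k F) G) f = pt (dsum F (\<lambda>x. G (k x))) (f \<circ> map_prod k id)"
    unfolding dsum_filtermap
  proof (rule pt_filtermap [where k' = "map_prod k' id"])
    show "ccuf TYPE('v) (dsum F (\<lambda>x. G (k x)))" by (rule ccuf_dsum [OF F G])
    show "\<forall>\<^sub>F x in dsum F (\<lambda>x. G (k x)). map_prod k' id (map_prod k id x) = x"
      unfolding eventually_dsum by (rule eventually_mono [OF k]) simp
  qed
  also have "f \<circ> map_prod k id = (\<lambda>(x, y). f (k x, y))" by auto
  finally show ?thesis .
qed

lemma range_pt_dsum_filtermap:
  fixes G :: "'b \<Rightarrow> 'c filter" and F :: "'a filter"
  assumes F: "ccuf TYPE('v::zfc) F" and k: "\<forall>\<^sub>F x in F. k' (k x) = x"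
    and G: "\<forall>\<^sub>F x in F. ccuf TYPE('v) (G (k x))"
  shows "range (pt (dsum (filtermap k F) G)) = (range (pt (dsum F (\<lambda>x. G (k x)))) :: 'v set)"
proof (intro equalityI subsetI)
  have D: "ccuf TYPE('v) (dsum F (\<lambda>x. G (k x)))" by (rule ccuf_dsum [OF F G])
  fix p :: 'v assume "p \<in> range (pt (dsum F (\<lambda>x. G (k x))))"
  then obtain f where f: "p = pt (dsum F (\<lambda>x. G (k x))) f" by blast
  have "p = pt (dsum (filtermap k F) G) (\<lambda>(x, y). f (k' x, y))"
    unfolding f pt_dsum_filtermap [where k = k and k' = k' and G = G, OF F k G]
    by (rule pt_cong [OF D], unfold eventually_dsum, rule eventually_mono [OF k]) simp
  then show "p \<in> range (pt (dsum (filtermap k F) G))" by blast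
qed (auto simp: pt_dsum_filtermap [where k = k and k' = k' and G = G, OF F k G])

text \<open>The axiom is applied to codes \<open>A\<close> and \<open>B\<close>. By Los' theorem its
  internal ultrafilters are represented by families \<open>z0\<close> and \<open>z1\<close> of
  ultrafilters, which are reindexed through the coding maps \<open>k\<close> and
  \<open>l\<close>.\<close>

lemma ultrapower_axiom_filters:
  fixes F :: "'a filter" and G :: "'b filter"
  assumes UA: "ultrapower_axiom (UNIV :: 'v::zfc set)"
    and F: "ccuf TYPE('v) F" and G: "ccuf TYPE('v) G"
  obtains Y :: "'a \<Rightarrow> 'v::zfc filter" and Z :: "'b \<Rightarrow> 'v filter"
  where "\<forall>\<^sub>F x in F. ccuf TYPE('v) (Y x)" "\<forall>\<^sub>F x in G. ccuf TYPE('v) (Z x)"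
    "range (pt (dsum F Y)) = (range (pt (dsum G Z)) :: 'v set)"
    "\<And>x :: 'v. pt (dsum F Y) (\<lambda>_. x) = pt (dsum G Z) (\<lambda>_. x)"
proof -
  obtain A :: 'v and k k' where A: "cc_ultrafilter UNIV A" "filt A = filtermap k F"
    and k: "\<forall>\<^sub>F x in F. k' (k x) = x"
    using ccuf_code [OF F] by blast
  obtain B :: 'v and l l' where B: "cc_ultrafilter UNIV B" "filt B = filtermap l G"
    and l: "\<forall>\<^sub>F x in G. l' (l x) = x"
    using ccuf_code [OF G] by blast
  obtain Z0 Z1 where Z0: "cc_ultrafilter (ultV A) Z0" and Z1: "cc_ultrafilter (ultV B) Z1"
    and eq: "ultrapower (ultV A) Z0 = ultrapower (ultV B) Z1"
    and emb: "\<And>x. ult_emb (ultV A) Z0 (embV A x) = ult_emb (ultV B) Z1 (embV B x)"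
    using UA A(1) B(1) unfolding ultrapower_axiom_def by blast
  have "Z0 \<in> range (pt (filt A))" "Z1 \<in> range (pt (filt B))"
    using cc_ultrafilterD(1) [OF Z0] cc_ultrafilterD(1) [OF Z1]
    by (simp_all add: ultrafilter_on_def ultrapower_UNIV A(1) B(1))
  then obtain z0 z1 where z: "Z0 = pt (filt A) z0" "Z1 = pt (filt B) z1" by blast
  have z0: "\<forall>\<^sub>F x in filt A. cc_ultrafilter UNIV (z0 x)"
    using Z0 by (simp add: z ultrapower_UNIV A(1) pt_cc_ultrafilter [OF ccuf_filt])
  have z1: "\<forall>\<^sub>F x in filt B. cc_ultrafilter UNIV (z1 x)"
    using Z1 by (simp add: z ultrapower_UNIV B(1) pt_cc_ultrafilter [OF ccuf_filt])
  have Y: "\<forall>\<^sub>F x in F. ccuf TYPE('v) (filt (z0 (k x)))"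
    using z0 unfolding A(2) eventually_filtermap by (rule eventually_mono) (rule ccuf_filt)
  have Z: "\<forall>\<^sub>F x in G. ccuf TYPE('v) (filt (z1 (l x)))"
    using z1 unfolding B(2) eventually_filtermap by (rule eventually_mono) (rule ccuf_filt)
  show thesis
  proof (rule that [OF Y Z])
    have "range (pt (dsum (filt A) (\<lambda>x. filt (z0 x)))) = (range (pt (dsum (filt B) (\<lambda>x. filt (z1 x)))) :: 'v set)"
      using eq by (simp add: z ultrapower_UNIV A(1) B(1) ultrapower_range_pt [OF ccuf_filt] z0 z1)
    then show "range (pt (dsum F (\<lambda>x. filt (z0 (k x))))) = (range (pt (dsum G (\<lambda>x. filt (z1 (l x))))) :: 'v set)"
      unfolding A(2) B(2)
      by (simp add: range_pt_dsum_filtermap [where k = k and k' = k' and G = "\<lambda>x. filt (z0 x)", OF F k Y] range_pt_dsum_filtermap [where k = l and k' = l' and G = "\<lambda>x. filt (z1 x)", OF G l Z])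
    show "pt (dsum F (\<lambda>x. filt (z0 (k x)))) (\<lambda>_. x) = pt (dsum G (\<lambda>x. filt (z1 (l x)))) (\<lambda>_. x)" for x :: 'v
    proof -
      have "pt (dsum (filt A) (\<lambda>x. filt (z0 x))) (\<lambda>(_, _). x) = pt (dsum (filt B) (\<lambda>x. filt (z1 x))) (\<lambda>(_, _). x)"
        using emb [of x]
        by (simp add: z ultrapower_UNIV A(1) B(1) ult_emb_UNIV ult_emb_pt [OF ccuf_filt] z0 z1)
      then show ?thesis
        unfolding A(2) B(2)
        by (simp add: pt_dsum_filtermap [where k = k and k' = k' and G = "\<lambda>x. filt (z0 x)", OF F k Y] pt_dsum_filtermap [where k = l and k' = l' and G = "\<lambda>x. filt (z1 x)", OF G l Z] case_prod_beta')
    qed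
  qed
qed

section \<open>Embeddings with the same target agree on ordinals\<close>

text \<open>Los' theorem for a class in place of a set: the target of an internal ultrapower is
  represented by the targets in the fibres.\<close>

lemma pt_mem_range_dsum:
  fixes f :: "'a \<Rightarrow> 'v::zfc"
  assumes F: "ccuf TYPE('v) F" and A: "\<forall>\<^sub>F x in F. ccuf TYPE('v) (A x)"
  shows "pt F f \<in> range (pt (dsum F A)) \<longleftrightarrow> (\<forall>\<^sub>F x in F. f x \<in> range (pt (A x)))"
proof -
  have "pt F f \<in> range (pt (dsum F A)) \<longleftrightarrow> (\<exists>g. \<forall>\<^sub>F x in F. f x = pt (A x) (\<lambda>y. g (x, y)))"
    by (simp add: image_iff pt_dsum [OF F A] pt_eq_iff [OF F])
  also have "\<dots> \<longleftrightarrow> (\<exists>h. \<forall>\<^sub>F x in F. f x = pt (A x) (h x))"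
  proof
    assume "\<exists>h. \<forall>\<^sub>F x in F. f x = pt (A x) (h x)"
    then obtain h where "\<forall>\<^sub>F x in F. f x = pt (A x) (\<lambda>y. (case_prod h) (x, y))" by auto
    then show "\<exists>g. \<forall>\<^sub>F x in F. f x = pt (A x) (\<lambda>y. g (x, y))" by (intro exI)
  next
    assume "\<exists>g. \<forall>\<^sub>F x in F. f x = pt (A x) (\<lambda>y. g (x, y))"
    then obtain g where "\<forall>\<^sub>F x in F. f x = pt (A x) ((\<lambda>x y. g (x, y)) x)" by auto
    then show "\<exists>h. \<forall>\<^sub>F x in F. f x = pt (A x) (h x)" by (intro exI)
  qed
  finally show ?thesis by (simp add: image_iff eventually_ex_iff)
qed

lemma range_pt_dsum_subset:
  fixes F :: "'a filter"
  assumes F: "ccuf TYPE('v::zfc) F" and A: "\<forall>\<^sub>F x in F. ccuf TYPE('v) (A x)"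
  shows "range (pt (dsum F A)) \<subseteq> (range (pt F) :: 'v set)"
  by (auto simp: pt_dsum [OF F A])

lemma range_pt_dsum_mono:
  fixes F :: "'a filter"
  assumes F: "ccuf TYPE('v::zfc) F" and A: "\<forall>\<^sub>F x in F. ccuf TYPE('v) (A x)"
    and B: "\<forall>\<^sub>F x in F. ccuf TYPE('v) (B x)"
  shows "range (pt (dsum F A)) \<subseteq> (range (pt (dsum F B)) :: 'v set) \<longleftrightarrow>
    (\<forall>\<^sub>F x in F. range (pt (A x)) \<subseteq> (range (pt (B x)) :: 'v set))"
proof -
  have "range (pt (dsum F A)) \<subseteq> (range (pt (dsum F B)) :: 'v set) \<longleftrightarrow>
     (\<forall>f. pt F f \<in> range (pt (dsum F A)) \<longrightarrow> (pt F f :: 'v) \<in> range (pt (dsum F B)))" (is "?X \<subseteq> ?Y \<longleftrightarrow> _")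
  proof
    assume *: "\<forall>f. pt F f \<in> ?X \<longrightarrow> pt F f \<in> ?Y"
    show "?X \<subseteq> ?Y"
    proof
      fix y assume y: "y \<in> ?X"
      then obtain f where "y = pt F f" using range_pt_dsum_subset [OF F A] by auto
      then show "y \<in> ?Y" using * y by simp
    qed
  qed (simp add: subset_iff)
  also have "\<dots> \<longleftrightarrow> (\<forall>\<^sub>F x in F. \<forall>y. y \<in> range (pt (A x)) \<longrightarrow> (y :: 'v) \<in> range (pt (B x)))"
    by (simp only: pt_mem_range_dsum [OF F A] pt_mem_range_dsum [OF F B]
        eventually_all_iff [OF F] eventually_imp [OF F])
  finally show ?thesis by (simp only: subset_iff)
qed

text \<open>Pulls the comparison of two target classes back into the model given by
  \<open>F\<close>.\<close>

lemma range_pt_dsum_eq_iff: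
  fixes F :: "'a filter"
  assumes F: "ccuf TYPE('v::zfc) F" and A: "\<forall>\<^sub>F x in F. ccuf TYPE('v) (A x)"
    and B: "\<forall>\<^sub>F x in F. ccuf TYPE('v) (B x)"
  shows "range (pt (dsum F A)) = (range (pt (dsum F B)) :: 'v set) \<longleftrightarrow>
    (\<forall>\<^sub>F x in F. range (pt (A x)) = (range (pt (B x)) :: 'v set))"
  unfolding set_eq_subset eventually_conj_iff
  by (simp only: range_pt_dsum_mono [OF F A B] range_pt_dsum_mono [OF F B A])

text \<open>
  The least ordinal with this property would be mapped to the least one of the target by both
  embeddings, since the property refers to the target only through the class \<open>M\<close>.
\<close>

definition disagree :: "'v::zfc set \<Rightarrow> 'v \<Rightarrow> bool" where
  "disagree M \<alpha> \<longleftrightarrow> (\<exists>Z\<in>M. \<exists>Z'\<in>M. cc_ultrafilter M Z \<and> cc_ultrafilter M Z' \<and>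
     ultrapower M Z = ultrapower M Z' \<and> ult_emb M Z \<alpha> \<noteq> ult_emb M Z' \<alpha>)"

text \<open>Besides quantifiers over the model, \<open>disagree\<close> contains an equality of
  proper classes, which \<open>range_pt_dsum_eq_iff\<close> transfers.\<close>

lemma pt_disagree:
  fixes f :: "'a \<Rightarrow> 'v::zfc"
  assumes F: "ccuf TYPE('v) F"
  shows "disagree (range (pt F)) (pt F f) \<longleftrightarrow> (\<forall>\<^sub>F x in F. disagree UNIV (f x))"
  unfolding disagree_def bex_UNIV
proof (rule pt_ex [OF F], rule pt_ex [OF F])
  let ?M = "range (pt F) :: 'v set"
  fix Z Z' :: "'a \<Rightarrow> 'v"
  show "(cc_ultrafilter ?M (pt F Z) \<and> cc_ultrafilter ?M (pt F Z') \<and>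
      ultrapower ?M (pt F Z) = ultrapower ?M (pt F Z') \<and>
      ult_emb ?M (pt F Z) (pt F f) \<noteq> ult_emb ?M (pt F Z') (pt F f)) \<longleftrightarrow>
    (\<forall>\<^sub>F x in F. cc_ultrafilter UNIV (Z x) \<and> cc_ultrafilter UNIV (Z' x) \<and>
      ultrapower UNIV (Z x) = ultrapower UNIV (Z' x) \<and>
      ult_emb UNIV (Z x) (f x) \<noteq> ult_emb UNIV (Z' x) (f x))"
  proof (cases "(\<forall>\<^sub>F x in F. cc_ultrafilter UNIV (Z x)) \<and> (\<forall>\<^sub>F x in F. cc_ultrafilter UNIV (Z' x))")
    case True
    then have Z: "\<forall>\<^sub>F x in F. cc_ultrafilter UNIV (Z x)"
      and Z': "\<forall>\<^sub>F x in F. cc_ultrafilter UNIV (Z' x)" by auto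
    have c: "\<forall>\<^sub>F x in F. ccuf TYPE('v) (filt (Z x))" "\<forall>\<^sub>F x in F. ccuf TYPE('v) (filt (Z' x))"
      by (rule eventually_mono [OF Z], erule ccuf_filt) (rule eventually_mono [OF Z'], erule ccuf_filt)
    have 1: "ultrapower ?M (pt F Z) = ultrapower ?M (pt F Z') \<longleftrightarrow>
        (\<forall>\<^sub>F x in F. ultrapower UNIV (Z x) = ultrapower UNIV (Z' x))"
      unfolding ultrapower_range_pt [OF F Z] ultrapower_range_pt [OF F Z']
        range_pt_dsum_eq_iff [OF F c]
      by (rule eventually_subst, rule eventually_elim2 [OF Z Z']) (simp add: ultrapower_UNIV)
    have "ult_emb ?M (pt F Z) (pt F f) = ult_emb ?M (pt F Z') (pt F f) \<longleftrightarrow>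
        (\<forall>\<^sub>F x in F. pt (filt (Z x)) (\<lambda>_. f x) = pt (filt (Z' x)) (\<lambda>_. f x))"
      by (simp add: ult_emb_pt [OF F Z] ult_emb_pt [OF F Z'] pt_dsum [OF F] c pt_eq_iff [OF F])
    also have "\<dots> \<longleftrightarrow> (\<forall>\<^sub>F x in F. ult_emb UNIV (Z x) (f x) = ult_emb UNIV (Z' x) (f x))"
      by (rule eventually_subst, rule eventually_elim2 [OF Z Z']) (simp add: ult_emb_UNIV)
    finally show ?thesis
      using Z Z' 1 by (simp add: pt_cc_ultrafilter [OF F] eventually_conj_iff eventually_not [OF F])
  qed (auto simp: pt_cc_ultrafilter [OF F] eventually_conj_iff)
qed

lemma not_disagree_Ord: "Ord \<alpha> \<Longrightarrow> \<not> disagree (UNIV :: 'v::zfc set) \<alpha>"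
proof (induction \<alpha> rule: wf_induct_rule [OF wf_elts])
  case (1 \<alpha>)
  \<comment> \<open>\<open>A\<close> sends \<alpha> above its image under \<open>B\<close>. That
    image has the property in the common target, by Los' theorem for \<open>B\<close>; read through
    \<open>A\<close>, it is represented by ordinals below \<alpha>, which then have the property
    too.\<close>
  have False
    if A: "ccuf TYPE('v) A" and B: "ccuf TYPE('v) B"
      and eq: "range (pt A) = (range (pt B) :: 'v set)"
      and mem: "pt B (\<lambda>_. \<alpha>) \<in> elts (pt A (\<lambda>_. \<alpha>))" and d: "disagree UNIV \<alpha>"
    for A B :: "'v filter"
  proof -
    obtain h where h: "pt B (\<lambda>_. \<alpha>) = pt A h" "\<forall>\<^sub>F x in A. h x \<in> elts \<alpha>"
      using mem by (rule mem_ptE [OF A])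
    have "disagree (range (pt B)) (pt B (\<lambda>_. \<alpha>))"
      using d by (simp add: pt_disagree [OF B])
    then have "\<forall>\<^sub>F x in A. disagree UNIV (h x)"
      by (simp add: h(1) pt_disagree [OF A] flip: eq)
    with h(2) obtain x where "h x \<in> elts \<alpha>" "disagree UNIV (h x)"
      using eventually_happens_ccuf [OF A eventually_conj] by blast
    then show False using 1 Ord_elts by blast
  qed
  note * = this
  show ?case
  proof
    assume d: "disagree UNIV \<alpha>"
    then obtain Z Z' :: 'v where Z: "cc_ultrafilter UNIV Z" "cc_ultrafilter UNIV Z'"
      and "ultrapower UNIV Z = ultrapower UNIV Z'" "ult_emb UNIV Z \<alpha> \<noteq> ult_emb UNIV Z' \<alpha>"
      unfolding disagree_def by blast
    then have eq: "range (pt (filt Z)) = (range (pt (filt Z')) :: 'v set)"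
      and ne: "pt (filt Z) (\<lambda>_. \<alpha>) \<noteq> pt (filt Z') (\<lambda>_. \<alpha>)"
      by (simp_all add: ultrapower_UNIV ult_emb_UNIV)
    note c = ccuf_filt [OF Z(1)] ccuf_filt [OF Z(2)]
    have "Ord (pt (filt Z) (\<lambda>_. \<alpha>))" "Ord (pt (filt Z') (\<lambda>_. \<alpha>))"
      using \<open>Ord \<alpha>\<close> by (simp_all add: pt_Ord c)
    then show False
      using Ord_linear ne *[OF c eq _ d] *[OF c(2) c(1) eq [symmetric] _ d] by blast
  qed
qed

lemma range_pt_filtermap:
  fixes F :: "'a filter"
  assumes F: "ccuf TYPE('v::zfc) F" and k: "\<forall>\<^sub>F x in F. k' (k x) = x"
  shows "range (pt (filtermap k F)) = (range (pt F) :: 'v set)"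
proof (intro equalityI subsetI)
  fix p :: 'v assume "p \<in> range (pt F)"
  then obtain f where f: "p = pt F f" by blast
  have "p = pt (filtermap k F) (f \<circ> k')"
    unfolding f pt_filtermap [where k = k and k' = k', OF F k]
    by (rule pt_cong [OF F], rule eventually_mono [OF k]) simp
  then show "p \<in> range (pt (filtermap k F))" by blast
qed (auto simp: pt_filtermap [where k = k and k' = k', OF F k])

lemma pt_const_agree:
  fixes A :: "'a filter" and B :: "'b filter"
  assumes A: "ccuf TYPE('v::zfc) A" and B: "ccuf TYPE('v) B"
    and eq: "range (pt A) = (range (pt B) :: 'v set)" and \<alpha>: "Ord (\<alpha> :: 'v)"
  shows "pt A (\<lambda>_. \<alpha>) = pt B (\<lambda>_. \<alpha>)"
proof -
  obtain Z :: 'v and k k' where Z: "cc_ultrafilter UNIV Z" "filt Z = filtermap k A"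
    and k: "\<forall>\<^sub>F x in A. k' (k x) = x"
    using ccuf_code [OF A] by blast
  obtain Y :: 'v and l l' where Y: "cc_ultrafilter UNIV Y" "filt Y = filtermap l B"
    and l: "\<forall>\<^sub>F x in B. l' (l x) = x"
    using ccuf_code [OF B] by blast
  have "ultrapower UNIV Z = range (pt A)" "ultrapower UNIV Y = range (pt B)"
    by (simp_all add: Z Y ultrapower_UNIV range_pt_filtermap [where k = k and k' = k', OF A k]
        range_pt_filtermap [where k = l and k' = l', OF B l])
  then have "ult_emb UNIV Z \<alpha> = ult_emb UNIV Y \<alpha>"
    using not_disagree_Ord [OF \<alpha>] Z Y eq unfolding disagree_def by auto
  moreover have "ult_emb UNIV Z \<alpha> = pt A (\<lambda>_. \<alpha>)" "ult_emb UNIV Y \<alpha> = pt B (\<lambda>_. \<alpha>)"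
    by (simp_all add: Z Y ult_emb_UNIV pt_filtermap [where k = k and k' = k', OF A k]
        pt_filtermap [where k = l and k' = l', OF B l] o_def)
  ultimately show ?thesis by simp
qed

text \<open>\<open>pt_const_agree\<close> relativized to the ultrapower by \<open>F\<close>: there
  \<open>f\<close> represents an ordinal, and \<open>A\<close> and \<open>B\<close> two ultrafilters
  with the same target. The injections \<pi> and \<rho> allow for coordinates that come in another
  order.\<close>

lemma pt_agree_dsum:
  fixes F :: "'a filter" and A :: "'a \<Rightarrow> 'b filter" and B :: "'a \<Rightarrow> 'c filter"
  assumes F: "ccuf TYPE('v::zfc) F" and A: "\<forall>\<^sub>F x in F. ccuf TYPE('v) (A x)"
    and B: "\<forall>\<^sub>F x in F. ccuf TYPE('v) (B x)"
    and \<pi>: "\<And>x. \<pi>' (\<pi> x) = x" and \<rho>: "\<And>x. \<rho>' (\<rho> x) = x"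
    and eq: "range (pt (filtermap \<pi> (dsum F A))) = (range (pt (filtermap \<rho> (dsum F B))) :: 'v set)"
    and f: "\<forall>\<^sub>F x in F. Ord (f x :: 'v)"
    and p: "\<And>x y. p (\<pi> (x, y)) = f x" and q: "\<And>x y. q (\<rho> (x, y)) = f x"
  shows "pt (filtermap \<pi> (dsum F A)) p = pt (filtermap \<rho> (dsum F B)) q"
proof -
  note FA = ccuf_dsum [OF F A] and FB = ccuf_dsum [OF F B]
  have \<pi>e: "\<forall>\<^sub>F x in dsum F A. \<pi>' (\<pi> x) = x" and \<rho>e: "\<forall>\<^sub>F x in dsum F B. \<rho>' (\<rho> x) = x"
    by (simp_all add: \<pi> \<rho>)
  have "range (pt (dsum F A)) = (range (pt (dsum F B)) :: 'v set)"
    using eq by (simp add: range_pt_filtermap [where k = \<pi> and k' = \<pi>', OF FA \<pi>e]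
        range_pt_filtermap [where k = \<rho> and k' = \<rho>', OF FB \<rho>e])
  then have "\<forall>\<^sub>F x in F. range (pt (A x)) = (range (pt (B x)) :: 'v set)"
    by (simp only: range_pt_dsum_eq_iff [OF F A B])
  with A B f have "\<forall>\<^sub>F x in F. pt (A x) (\<lambda>_. f x) = pt (B x) (\<lambda>_. f x)"
    by eventually_elim (rule pt_const_agree)
  then show ?thesis
    by (simp add: pt_filtermap [where k = \<pi> and k' = \<pi>', OF FA \<pi>e] p q
        pt_filtermap [where k = \<rho> and k' = \<rho>', OF FB \<rho>e] pt_dsum [OF F] A B pt_eq_iff [OF F])
qed

section \<open>The internal relation\<close>

text \<open>
  The family \<open>F'\<close> represents an ultrafilter of the ultrapower by \<open>D\<close> whose embedding is the restriction
  of the embedding by \<open>F\<close>.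
\<close>

definition internal :: "'v::zfc itself \<Rightarrow> 'a filter \<Rightarrow> 'b filter \<Rightarrow> bool" where
  "internal T F D \<longleftrightarrow> (\<exists>F'. (\<forall>\<^sub>F d in D. ccuf T (F' d)) \<and>
     (\<forall>\<phi>. (\<forall>\<^sub>F a in F. \<forall>\<^sub>F d in D. \<phi> a d) \<longleftrightarrow> (\<forall>\<^sub>F d in D. \<forall>\<^sub>F a in F' d. \<phi> a d)))"

lemma internalE:
  assumes "internal TYPE('v::zfc) F D"
  obtains F' where "\<forall>\<^sub>F d in D. ccuf TYPE('v) (F' d)"
    "\<And>\<phi>. (\<forall>\<^sub>F a in F. \<forall>\<^sub>F d in D. \<phi> a d) \<longleftrightarrow> (\<forall>\<^sub>F d in D. \<forall>\<^sub>F a in F' d. \<phi> a d)"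
  using assms unfolding internal_def by blast

lemma internal_filtermap:
  assumes "internal TYPE('v::zfc) F D" and k: "\<And>x. k' (k x) = x"
  shows "internal TYPE('v) F (filtermap k D)"
proof -
  obtain F' where F': "\<forall>\<^sub>F d in D. ccuf TYPE('v) (F' d)"
    "\<And>\<phi>. (\<forall>\<^sub>F a in F. \<forall>\<^sub>F d in D. \<phi> a d) \<longleftrightarrow> (\<forall>\<^sub>F d in D. \<forall>\<^sub>F a in F' d. \<phi> a d)"
    using assms(1) by (rule internalE) blast
  show ?thesis
    unfolding internal_def eventually_filtermap
    by (rule exI [of _ "\<lambda>d. F' (k' d)"]) (simp add: k F')
qed

text \<open>A well-ordering of the support, collapsed to an ordinal.\<close>

lemma ccuf_ordinal_code:
  fixes F :: "'a filter"
  assumes F: "ccuf TYPE('v::zfc) F"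
  obtains e :: "'a \<Rightarrow> 'v::zfc" and e' where "\<forall>\<^sub>F x in F. Ord (e x) \<and> e' (e x) = x"
proof -
  obtain A where A: "vsmall TYPE('v) A" "\<forall>\<^sub>F x in F. x \<in> A"
    using F unfolding ccuf_def by blast
  obtain r where r: "well_order_on A r" using well_order_on by blast
  define R where "R = r - Id"
  have wfR: "wf R" using r unfolding R_def well_order_on_def by blast
  have RA: "x \<in> A" "y \<in> A" if "(x, y) \<in> R" for x y
    using that well_order_on_domain [OF r] unfolding R_def by blast+
  have lin: "linear_order_on A r" using r by (simp add: well_order_on_def)
  have trans: "(x, z) \<in> R" if "(x, y) \<in> R" "(y, z) \<in> R" for x y z
    using that lin unfolding R_def order_on_defs by (auto dest: transD antisymD)
  have total: "(x, y) \<in> R \<or> (y, x) \<in> R" if "x \<in> A" "y \<in> A" "x \<noteq> y" for x y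
    using that lin unfolding R_def order_on_defs total_on_def by blast
  define e :: "'a \<Rightarrow> 'v" where "e = wfrec R (\<lambda>e x. set_of (e ` {y. (y, x) \<in> R}))"
  have small: "small (g ` {y. (y, x) \<in> R})" for g :: "'a \<Rightarrow> 'v" and x
  proof -
    have "vsmall TYPE('v) (g ` {y. (y, x) \<in> R})"
      by (rule vsmall_image, rule vsmall_subset [OF A(1)]) (use RA in blast)
    then show ?thesis by (simp add: vsmall_iff_small)
  qed
  have e: "elts (e x) = e ` {y. (y, x) \<in> R}" for x
  proof -
    have "e x = set_of (cut e R x ` {y. (y, x) \<in> R})"
      unfolding e_def by (subst wfrec [OF wfR]) simp
    then have "elts (e x) = cut e R x ` {y. (y, x) \<in> R}" by (simp add: small)
    also have "\<dots> = e ` {y. (y, x) \<in> R}"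
      by (rule image_cong) (simp_all add: cut_apply)
    finally show ?thesis .
  qed
  have sub: "elts (e y) \<subseteq> elts (e x)" if "(y, x) \<in> R" for x y
    using that by (auto simp: e intro: trans)
  have "Ord (e x)" for x
    unfolding Ord_def using sub by (auto simp: e)
  moreover have "inj_on e A"
  proof (rule inj_onI, rule ccontr)
    fix x y assume xy: "x \<in> A" "y \<in> A" "e x = e y" "x \<noteq> y"
    have "e a \<in> elts (e b)" if "(a, b) \<in> R" for a b
      using that by (auto simp: e)
    then show False using total [OF xy(1,2,4)] xy(3) not_mem_self by metis
  qed
  ultimately have "\<forall>\<^sub>F x in F. Ord (e x) \<and> inv_into A e (e x) = x"
    by (intro eventually_mono [OF A(2)]) simp
  then show thesis by (rule that)
qed

text \<open>The hypotheses move a coordinate to the front of \<open>U \<times> W \<times> D\<close>: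
  \<open>U I W\<close> exchanges \<open>U\<close> with \<open>W\<close>, while \<open>W I D\<close>
  and \<open>U I D\<close> carry \<open>D\<close> past \<open>W\<close> and \<open>U\<close>. Both
  sides of the comparison thus become ultrapowers of the one by \<open>W\<close>, respectively
  \<open>D\<close>, and \<open>pt_agree_dsum\<close> applies to its seed.\<close>

lemma internal_dsum:
  fixes U :: "'a filter" and W :: "'b filter" and D :: "'c filter"
  assumes UA: "ultrapower_axiom (UNIV :: 'v::zfc set)"
    and cU: "ccuf TYPE('v) U" and cW: "ccuf TYPE('v) W" and cD: "ccuf TYPE('v) D"
    and UW: "internal TYPE('v) U W" and UD: "internal TYPE('v) U D" and WD: "internal TYPE('v) W D"
  shows "internal TYPE('v) U (dsum W (\<lambda>_. D))"
proof -
  obtain Uw where Uw: "\<forall>\<^sub>F w in W. ccuf TYPE('v) (Uw w)"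
    and UwI: "\<And>\<phi>. (\<forall>\<^sub>F a in U. \<forall>\<^sub>F w in W. \<phi> a w) \<longleftrightarrow> (\<forall>\<^sub>F w in W. \<forall>\<^sub>F a in Uw w. \<phi> a w)"
    using UW by (rule internalE) blast
  obtain Ud where Ud: "\<forall>\<^sub>F d in D. ccuf TYPE('v) (Ud d)"
    and UdI: "\<And>\<phi>. (\<forall>\<^sub>F a in U. \<forall>\<^sub>F d in D. \<phi> a d) \<longleftrightarrow> (\<forall>\<^sub>F d in D. \<forall>\<^sub>F a in Ud d. \<phi> a d)"
    using UD by (rule internalE) blast
  obtain Wd where Wd: "\<forall>\<^sub>F d in D. ccuf TYPE('v) (Wd d)"
    and WdI: "\<And>\<phi>. (\<forall>\<^sub>F w in W. \<forall>\<^sub>F d in D. \<phi> w d) \<longleftrightarrow> (\<forall>\<^sub>F d in D. \<forall>\<^sub>F w in Wd d. \<phi> w d)"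
    using WD by (rule internalE) blast
  define G where "G = dsum W (\<lambda>_. D)"
  define T where "T = dsum U (\<lambda>_. G)"
  have cG: "ccuf TYPE('v) G" unfolding G_def by (rule ccuf_dsum [OF cW]) (simp add: cD)
  have cT: "ccuf TYPE('v) T" unfolding T_def by (rule ccuf_dsum [OF cU]) (simp add: cG)
  obtain Y :: "_ \<Rightarrow> 'v filter" and Z :: "_ \<Rightarrow> 'v filter"
    where Y: "\<forall>\<^sub>F t in T. ccuf TYPE('v) (Y t)" and Z: "\<forall>\<^sub>F g in G. ccuf TYPE('v) (Z g)"
      and same: "range (pt (dsum T Y)) = (range (pt (dsum G Z)) :: 'v set)"
      and const: "\<And>x :: 'v. pt (dsum T Y) (\<lambda>_. x) = pt (dsum G Z) (\<lambda>_. x)"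
    using ultrapower_axiom_filters [OF UA cT cG] by metis
  have cTY: "ccuf TYPE('v) (dsum T Y)" by (rule ccuf_dsum [OF cT Y])
  have cGZ: "ccuf TYPE('v) (dsum G Z)" by (rule ccuf_dsum [OF cG Z])
  \<comment> \<open>Agreement is known for ordinals only, so each seed is replaced by an ordinal
    code.\<close>
  obtain eU :: "'a \<Rightarrow> 'v" and eU' where eU: "\<forall>\<^sub>F x in U. Ord (eU x) \<and> eU' (eU x) = x"
    using ccuf_ordinal_code [OF cU] by blast
  obtain eW :: "'b \<Rightarrow> 'v" and eW' where eW: "\<forall>\<^sub>F x in W. Ord (eW x) \<and> eW' (eW x) = x"
    using ccuf_ordinal_code [OF cW] by blast
  obtain eD :: "'c \<Rightarrow> 'v" and eD' where eD: "\<forall>\<^sub>F x in D. Ord (eD x) \<and> eD' (eD x) = x"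
    using ccuf_ordinal_code [OF cD] by blast

  have agreeW: "pt (dsum T Y) (\<lambda>((a, w, d), y). eW w) = pt (dsum G Z) (\<lambda>((w, d), z). eW w)"
  proof -
    \<comment> \<open>Both models are internal ultrapowers of the ultrapower by \<open>W\<close>.\<close>
    define A where "A w = dsum (Uw w) (\<lambda>a. dsum D (\<lambda>d. Y (a, w, d)))" for w
    define B where "B w = dsum D (\<lambda>d. Z (w, d))" for w
    define \<pi> :: "'b \<times> 'a \<times> 'c \<times> 'v \<Rightarrow> ('a \<times> 'b \<times> 'c) \<times> 'v" where "\<pi> = (\<lambda>(w, a, d, y). ((a, w, d), y))"
    define \<rho> :: "'b \<times> 'c \<times> 'v \<Rightarrow> ('b \<times> 'c) \<times> 'v" where "\<rho> = (\<lambda>(w, d, z). ((w, d), z))"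
    have T: "dsum T Y = filtermap \<pi> (dsum W A)"
      by (rule filter_eqI) (simp add: eventually_dsum eventually_filtermap T_def G_def A_def \<pi>_def UwI)
    have G: "dsum G Z = filtermap \<rho> (dsum W B)"
      by (rule filter_eqI) (simp add: eventually_dsum eventually_filtermap G_def B_def \<rho>_def)
    have "\<forall>\<^sub>F w in W. \<forall>\<^sub>F a in Uw w. \<forall>\<^sub>F d in D. ccuf TYPE('v) (Y (a, w, d))"
      using Y by (simp add: eventually_dsum T_def G_def UwI)
    with Uw have A: "\<forall>\<^sub>F w in W. ccuf TYPE('v) (A w)"
      unfolding A_def
      by eventually_elim (intro ccuf_dsum, assumption, erule eventually_mono, rule ccuf_dsum [OF cD])
    have B: "\<forall>\<^sub>F w in W. ccuf TYPE('v) (B w)"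
      using Z unfolding B_def G_def eventually_dsum by (rule eventually_mono) (rule ccuf_dsum [OF cD])
    have O: "\<forall>\<^sub>F w in W. Ord (eW w)" using eW by (rule eventually_mono) blast
    show ?thesis
      unfolding T G
      by (rule pt_agree_dsum [OF cW A B, where f = eW and \<pi>' = "\<lambda>((a, w, d), y). (w, a, d, y)" and \<rho>' = "\<lambda>((w, d), z). (w, d, z)"])
        (use same O in \<open>auto simp: \<pi>_def \<rho>_def T G\<close>)
  qed
  have agreeD: "pt (dsum T Y) (\<lambda>((a, w, d), y). eD d) = pt (dsum G Z) (\<lambda>((w, d), z). eD d)"
  proof -
    \<comment> \<open>Now \<open>D\<close> has to be outermost, so \<open>Wd\<close> takes the place
      of \<open>W\<close> on both sides.\<close>
    define A where "A d = dsum (Ud d) (\<lambda>a. dsum (Wd d) (\<lambda>w. Y (a, w, d)))" for d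
    define B where "B d = dsum (Wd d) (\<lambda>w. Z (w, d))" for d
    define \<pi> :: "'c \<times> 'a \<times> 'b \<times> 'v \<Rightarrow> ('a \<times> 'b \<times> 'c) \<times> 'v" where "\<pi> = (\<lambda>(d, a, w, y). ((a, w, d), y))"
    define \<rho> :: "'c \<times> 'b \<times> 'v \<Rightarrow> ('b \<times> 'c) \<times> 'v" where "\<rho> = (\<lambda>(d, w, z). ((w, d), z))"
    have T: "dsum T Y = filtermap \<pi> (dsum D A)"
      by (rule filter_eqI)
        (simp add: eventually_dsum eventually_filtermap T_def G_def A_def \<pi>_def WdI UdI)
    have G: "dsum G Z = filtermap \<rho> (dsum D B)"
      by (rule filter_eqI) (simp add: eventually_dsum eventually_filtermap G_def B_def \<rho>_def WdI)
    have "\<forall>\<^sub>F d in D. \<forall>\<^sub>F a in Ud d. \<forall>\<^sub>F w in Wd d. ccuf TYPE('v) (Y (a, w, d))"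
      using Y by (simp add: eventually_dsum T_def G_def WdI UdI)
    with Ud Wd have A: "\<forall>\<^sub>F d in D. ccuf TYPE('v) (A d)"
      unfolding A_def
      by eventually_elim (intro ccuf_dsum, assumption, erule eventually_mono, rule ccuf_dsum)
    have "\<forall>\<^sub>F d in D. \<forall>\<^sub>F w in Wd d. ccuf TYPE('v) (Z (w, d))"
      using Z by (simp add: eventually_dsum G_def WdI)
    with Wd have B: "\<forall>\<^sub>F d in D. ccuf TYPE('v) (B d)"
      unfolding B_def by eventually_elim (rule ccuf_dsum)
    have O: "\<forall>\<^sub>F d in D. Ord (eD d)" using eD by (rule eventually_mono) blast
    show ?thesis
      unfolding T G
      by (rule pt_agree_dsum [OF cD A B, where f = eD and \<pi>' = "\<lambda>((a, w, d), y). (d, a, w, y)" and \<rho>' = "\<lambda>((w, d), z). (d, w, z)"])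
        (use same O in \<open>auto simp: \<pi>_def \<rho>_def T G\<close>)
  qed

  have "pt (dsum T Y) (\<lambda>((a, w, d), y). eU a) \<in> range (pt (dsum G Z))"
    using same by blast
  then obtain h where h: "pt (dsum T Y) (\<lambda>((a, w, d), y). eU a) = pt (dsum G Z) h"
    by blast
  \<comment> \<open>\<open>h\<close> represents, in the second model, the code of the seed of
    \<open>U\<close>. The ultrafilter derived from it over \<open>g\<close> is the image of
    \<open>Z g\<close> under the decoded \<open>h\<close>.\<close>
  define V where "V g = filtermap (\<lambda>z. eU' (h (g, z))) (Z g)" for g
  have V: "\<forall>\<^sub>F g in G. ccuf TYPE('v) (V g)"
    using Z unfolding V_def by (rule eventually_mono) (rule ccuf_filtermap)

  \<comment> \<open>By now, the type of \<open>(h, w, d)\<close> in the second model is \<open>U \<times> W \<times> D\<close>.\<close>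
  define c where "c u w d = opair u (opair (eW w) (eD d))" for u w d
  obtain X where X: "vsmall TYPE('v) X" "\<forall>\<^sub>F t in T. t \<in> X"
    using cT unfolding ccuf_def by blast
  \<comment> \<open>A support on which all three codes decode correctly; being set-sized, it makes
    \<open>K\<close> below a set.\<close>
  define X' where "X' = {(a, w, d) \<in> X. eU' (eU a) = a \<and> eW' (eW w) = w \<and> eD' (eD d) = d}"
  have X': "\<forall>\<^sub>F t in T. t \<in> X'"
  proof -
    have "\<forall>\<^sub>F t in T. case t of (a, w, d) \<Rightarrow> eU' (eU a) = a \<and> eW' (eW w) = w \<and> eD' (eD d) = d"
      using eU eW eD
      by (simp add: T_def G_def eventually_dsum eventually_conj_iff
          eventually_const_iff [OF cU] eventually_const_iff [OF cW] eventually_const_iff [OF cD])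
    with X(2) show ?thesis by eventually_elim (auto simp: X'_def)
  qed
  have forward: "\<forall>\<^sub>F g in G. \<forall>\<^sub>F a in V g. \<phi> a g"
    if \<phi>: "\<forall>\<^sub>F a in U. \<forall>\<^sub>F g in G. \<phi> a g" for \<phi>
  proof -
    \<comment> \<open>That \<phi> holds almost everywhere for \<open>T\<close> becomes membership of
      the coded triple of seeds in the image of \<open>K\<close>. The two images of \<open>K\<close>
      coincide by \<open>const\<close>, the two coded triples by \<open>h\<close>,
      \<open>agreeW\<close> and \<open>agreeD\<close>.\<close>
    define K where "K = set_of ((\<lambda>(a, w, d). c (eU a) w d) ` {(a, w, d) \<in> X'. \<phi> a (w, d)})"
    have "vsmall TYPE('v) ((\<lambda>(a, w, d). c (eU a) w d) ` {(a, w, d) \<in> X'. \<phi> a (w, d)})"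
      by (rule vsmall_image, rule vsmall_subset [OF X(1)]) (auto simp: X'_def)
    then have K: "elts K = (\<lambda>(a, w, d). c (eU a) w d) ` {(a, w, d) \<in> X'. \<phi> a (w, d)}"
      unfolding K_def by (simp add: vsmall_iff_small)
    have K\<phi>: "\<phi> (eU' u) (w, d)" if u: "c u w d \<in> elts K" "eW' (eW w) = w" "eD' (eD d) = d" for u w d
    proof -
      obtain a w' d' where *: "(a, w', d') \<in> X'" "\<phi> a (w', d')" "c u w d = c (eU a) w' d'"
        using u(1) unfolding K by auto
      then have "eW w' = eW w" "eD d' = eD d" "u = eU a" by (auto simp: c_def)
      moreover have "eU' (eU a) = a" "eW' (eW w') = w'" "eD' (eD d') = d'"
        using *(1) by (auto simp: X'_def)
      ultimately have "a = eU' u" "w' = w" "d' = d" using u(2,3) by metis+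
      then show ?thesis using *(2) by simp
    qed
    have "\<forall>\<^sub>F t in T. (\<lambda>(a, w, d). c (eU a) w d) t \<in> elts K"
    proof -
      have "\<forall>\<^sub>F t in T. case t of (a, w, d) \<Rightarrow> \<phi> a (w, d)"
        using \<phi> by (simp add: T_def G_def eventually_dsum)
      with X' show ?thesis unfolding K by eventually_elim (rule imageI, auto)
    qed
    then have "\<forall>\<^sub>F p in dsum T Y. (\<lambda>((a, w, d), y). c (eU a) w d) p \<in> elts K"
      using Y unfolding eventually_dsum
      by eventually_elim (auto simp: eventually_const_iff)
    then have "pt (dsum T Y) (\<lambda>((a, w, d), y). c (eU a) w d) \<in> elts (pt (dsum T Y) (\<lambda>_. K))"
      by (simp add: pt_mem_iff [OF cTY])
    also have "pt (dsum T Y) (\<lambda>((a, w, d), y). c (eU a) w d) =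
        opair (pt (dsum T Y) (\<lambda>((a, w, d), y). eU a))
          (opair (pt (dsum T Y) (\<lambda>((a, w, d), y). eW w)) (pt (dsum T Y) (\<lambda>((a, w, d), y). eD d)))"
      by (simp add: pt_opair [OF cTY] c_def case_prod_beta')
    also have "\<dots> = pt (dsum G Z) (\<lambda>((w, d), z). c (h ((w, d), z)) w d)"
      unfolding h agreeW agreeD by (simp add: pt_opair [OF cGZ] c_def case_prod_beta')
    finally have "\<forall>\<^sub>F g in G. \<forall>\<^sub>F z in Z g. (\<lambda>(w, d). c (h ((w, d), z)) w d) g \<in> elts K"
      by (simp add: const pt_mem_iff [OF cGZ] eventually_dsum case_prod_beta')
    moreover have "\<forall>\<^sub>F g in G. case g of (w, d) \<Rightarrow> eW' (eW w) = w \<and> eD' (eD d) = d"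
      using eW eD
      by (simp add: G_def eventually_dsum eventually_conj_iff
          eventually_const_iff [OF cW] eventually_const_iff [OF cD])
    ultimately show ?thesis
      unfolding V_def eventually_filtermap
      by eventually_elim (auto elim!: eventually_mono intro: K\<phi>)
  qed
  \<comment> \<open>For ultrafilters the forward implication suffices: applied to the negation of
    \<phi> it gives the converse.\<close>
  have "(\<forall>\<^sub>F a in U. \<forall>\<^sub>F g in G. \<phi> a g) \<longleftrightarrow> (\<forall>\<^sub>F g in G. \<forall>\<^sub>F a in V g. \<phi> a g)" for \<phi>
  proof
    assume R: "\<forall>\<^sub>F g in G. \<forall>\<^sub>F a in V g. \<phi> a g"
    show "\<forall>\<^sub>F a in U. \<forall>\<^sub>F g in G. \<phi> a g"
    proof (rule ccontr)
      assume "\<not> ?thesis"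
      then have "\<forall>\<^sub>F a in U. \<forall>\<^sub>F g in G. \<not> \<phi> a g"
        by (simp add: eventually_not [OF cU] eventually_not [OF cG])
      then have "\<forall>\<^sub>F g in G. \<forall>\<^sub>F a in V g. \<not> \<phi> a g" by (rule forward)
      with V R have "\<forall>\<^sub>F g in G. False"
        by eventually_elim (simp add: eventually_not)
      then show False by (simp add: eventually_const_iff [OF cG])
    qed
  qed (rule forward)
  then show ?thesis
    using V unfolding internal_def G_def by blast
qed

section \<open>Descending sequences for the internal relation\<close>

text \<open>By induction, \<eta> < \<xi> gives \<eta> \<le> j(\<eta>) < j(\<xi>). Thus a moved
  ordinal is moved up, and every ordinal is a point of the ultrapower, which is transitive.\<close>

lemma Ord_pt_const:
  assumes F: "ccuf TYPE('v::zfc) F"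
  shows "Ord (\<xi> :: 'v) \<Longrightarrow> \<xi> = pt F (\<lambda>_. \<xi>) \<or> \<xi> \<in> elts (pt F (\<lambda>_. \<xi>))"
proof (induction \<xi> rule: wf_induct_rule [OF wf_elts])
  case (1 \<xi>)
  have O: "Ord (pt F (\<lambda>_. \<xi>))" using 1 by (simp add: pt_Ord [OF F])
  have "\<eta> \<in> elts (pt F (\<lambda>_. \<xi>))" if "\<eta> \<in> elts \<xi>" for \<eta>
  proof -
    have "pt F (\<lambda>_. \<eta>) \<in> elts (pt F (\<lambda>_. \<xi>))" using that by (simp add: pt_mem_iff [OF F])
    then show ?thesis
      using 1 that Ord_elts [OF \<open>Ord \<xi>\<close> that] Ord_transitive [OF O] by force
  qed
  then show ?case using Ord_subset_cases [OF \<open>Ord \<xi>\<close> O] by blast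
qed

text \<open>The newest coordinate is the head of the list and outermost in the product, so
  \<open>tl\<close> projects stage \<open>Suc n\<close> to stage \<open>n\<close>.\<close>

primrec rprod :: "(nat \<Rightarrow> 'a filter) \<Rightarrow> nat \<Rightarrow> 'a list filter" where
  "rprod W 0 = principal {[]}"
| "rprod W (Suc n) = filtermap (\<lambda>(x, s). x # s) (dsum (W n) (\<lambda>_. rprod W n))"

lemma ccuf_rprod:
  fixes W :: "nat \<Rightarrow> 'a filter"
  assumes "\<And>n. ccuf TYPE('v::zfc) (W n)"
  shows "ccuf TYPE('v) (rprod W n)"
proof (induction n)
  case 0
  have "(principal {[]} :: 'a list filter) = filtermap (\<lambda>_. []) (principal {()})"
    by (rule filter_eqI) (simp add: eventually_principal eventually_filtermap)
  moreover have "ccuf TYPE('v) (filtermap (\<lambda>_. [] :: 'a list) (principal {()}))"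
    by (rule ccuf_filtermap [OF ccuf_principal_unit])
  ultimately show ?case by simp
next
  case (Suc n)
  then show ?case by (simp add: ccuf_filtermap ccuf_dsum assms)
qed

text \<open>The case \<open>n = m\<close> is included because the induction step applies
  \<open>internal_dsum\<close> to \<open>W m\<close> and \<open>rprod W m\<close>, and this requires
  \<open>W m I rprod W m\<close>.\<close>

lemma internal_rprod:
  fixes W :: "nat \<Rightarrow> 'a filter"
  assumes UA: "ultrapower_axiom (UNIV :: 'v::zfc set)"
    and W: "\<And>n. ccuf TYPE('v) (W n)" and I: "\<And>m n. m < n \<Longrightarrow> internal TYPE('v) (W n) (W m)"
  shows "m \<le> n \<Longrightarrow> internal TYPE('v) (W n) (rprod W m)"
proof (induction m arbitrary: n)
  case 0
  show ?case
    unfolding internal_def by (rule exI [of _ "\<lambda>_. W n"]) (simp add: W eventually_principal)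
next
  case (Suc m)
  then have "internal TYPE('v) (W n) (dsum (W m) (\<lambda>_. rprod W m))"
    by (intro internal_dsum UA W ccuf_rprod I) auto
  then show ?case
    unfolding rprod.simps by (rule internal_filtermap [where k' = "\<lambda>l. (hd l, tl l)"]) auto
qed

lemma internal_sequence_fixes_Ord:
  fixes W :: "nat \<Rightarrow> 'a filter"
  assumes UA: "ultrapower_axiom (UNIV :: 'v::zfc set)"
    and W: "\<And>n. ccuf TYPE('v) (W n)" and I: "\<And>m n. m < n \<Longrightarrow> internal TYPE('v) (W n) (W m)"
    and \<xi>: "Ord (\<xi> :: 'v)"
  shows "\<exists>n. pt (W n) (\<lambda>_. \<xi>) = \<xi>"
proof (rule ccontr)
  assume "\<not> ?thesis"
  then have moved: "\<xi> \<in> elts (pt (W n) (\<lambda>_. \<xi>))" for n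
    using Ord_pt_const [OF W \<xi>] by metis
  define P where "P = rprod W"
  have cP: "ccuf TYPE('v) (P n)" for n unfolding P_def by (rule ccuf_rprod [OF W])
  have P_Suc: "P (Suc n) = filtermap (\<lambda>(x, s). x # s) (dsum (W n) (\<lambda>_. P n))" for n
    by (simp add: P_def)
  have cWP: "ccuf TYPE('v) (dsum (W n) (\<lambda>_. P n))" for n by (rule ccuf_dsum [OF W]) (simp add: cP)
  have "\<xi> \<in> range (pt (P n))" for n
    using Ord_pt_const [OF cP \<xi>, of n] range_pt_transitive [OF cP] by (metis rangeI)
  then have "\<exists>f. \<xi> = pt (P n) f" for n by blast
  then obtain f where f: "\<And>n. \<xi> = pt (P n) (f n)" by metis
  \<comment> \<open>The embedding of \<open>W n\<close> sends the point that \<open>f n\<close>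
    represents at stage \<open>n\<close> to the one that \<open>f n\<close> of the tail represents
    at stage \<open>Suc n\<close>. As \<xi> is moved up, \<open>f (Suc n)\<close> represents a
    smaller point.\<close>
  have desc: "\<forall>\<^sub>F l in P (Suc n). f (Suc n) l \<in> elts (f n (tl l))" for n
  proof -
    have k: "\<forall>\<^sub>F p in dsum (W n) (\<lambda>_. P n). (hd ((\<lambda>(x, s). x # s) p), tl ((\<lambda>(x, s). x # s) p)) = p"
      by (simp add: split_beta)
    have "pt (W n) (\<lambda>_. \<xi>) = pt (W n) (\<lambda>_. pt (P n) (f n))" using f by simp
    also have "\<dots> = pt (dsum (W n) (\<lambda>_. P n)) (\<lambda>(x, s). f n s)"
      by (simp add: pt_dsum [OF W] cP)
    also have "\<dots> = pt (P (Suc n)) (\<lambda>l. f n (tl l))"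
      unfolding P_Suc pt_filtermap [where k' = "\<lambda>l. (hd l, tl l)", OF cWP k]
      by (simp add: o_def case_prod_beta')
    finally have "pt (P (Suc n)) (f (Suc n)) \<in> elts (pt (P (Suc n)) (\<lambda>l. f n (tl l)))"
      using moved [of n] f by metis
    then show ?thesis by (simp add: pt_mem_iff [OF cP])
  qed
  have "\<exists>V. (\<forall>\<^sub>F s in P n. ccuf TYPE('v) (V s)) \<and> (\<forall>\<phi>. (\<forall>\<^sub>F a in W n. \<forall>\<^sub>F s in P n. \<phi> a s) \<longleftrightarrow>
      (\<forall>\<^sub>F s in P n. \<forall>\<^sub>F a in V s. \<phi> a s))" for n
    using internal_rprod [where W = W and m = n and n = n, OF UA W I] unfolding internal_def P_def by simp
  then obtain V where cV: "\<And>n. \<forall>\<^sub>F s in P n. ccuf TYPE('v) (V n s)"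
    and V: "\<And>n \<phi>. (\<forall>\<^sub>F a in W n. \<forall>\<^sub>F s in P n. \<phi> a s) \<longleftrightarrow> (\<forall>\<^sub>F s in P n. \<forall>\<^sub>F a in V n s. \<phi> a s)"
    by metis
  \<comment> \<open>After the exchange the newest coordinate is innermost, with an ultrafilter
    depending on the earlier ones, so a list can be extended point by point.\<close>
  have eventually_P_Suc: "eventually Q (P (Suc n)) \<longleftrightarrow> (\<forall>\<^sub>F s in P n. \<forall>\<^sub>F x in V n s. Q (x # s))" for n Q
    using V [where n = n and \<phi> = "\<lambda>x s. Q (x # s)"]
    by (simp add: P_def eventually_filtermap eventually_dsum)
  \<comment> \<open>\<open>E k n l\<close>: almost every extension of \<open>l\<close> by \<open>k\<close> further points continues the descent.\<close>
  define E where "E = rec_nat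
      (\<lambda>n l. ccuf TYPE('v) (V n l) \<and> (n \<noteq> 0 \<longrightarrow> f n l \<in> elts (f (n - 1) (tl l))))
      (\<lambda>k E n l. \<forall>\<^sub>F x in V n l. E (Suc n) (x # l))"
  \<comment> \<open>Stage 0 has no predecessor, hence the guard \<open>n \<noteq> 0\<close>; the
    descent is checked on arrival at stage \<open>n\<close>, against stage
    \<open>n - 1\<close>.\<close>
  have E0: "E 0 n l \<longleftrightarrow> ccuf TYPE('v) (V n l) \<and> (n \<noteq> 0 \<longrightarrow> f n l \<in> elts (f (n - 1) (tl l)))"
    and ES: "E (Suc k) n l \<longleftrightarrow> (\<forall>\<^sub>F x in V n l. E k (Suc n) (x # l))" for k n l
    by (simp_all add: E_def)
  have E: "\<forall>\<^sub>F l in P n. E k n l" for k n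
  proof (induction k arbitrary: n)
    case 0
    show ?case
      unfolding E0 using cV [of n] desc by (cases n) (simp_all add: eventually_conj_iff)
  next
    case (Suc k)
    from Suc [of "Suc n"] show ?case by (simp add: eventually_P_Suc ES)
  qed
  have start: "\<forall>k. E k 0 []"
    using E [where n = 0] by (simp add: P_def eventually_principal)
  \<comment> \<open>For each \<open>k\<close> almost every one-point extension satisfies
    \<open>E k\<close>; countable completeness yields one that does so for all \<open>k\<close> at
    once.\<close>
  have step: "\<exists>l'. (\<forall>k. E k (Suc n) l') \<and> tl l' = l" if "\<forall>k. E k n l" for n l
  proof -
    have "ccuf TYPE('v) (V n l)" using that E0 by blast
    moreover have "\<forall>k. \<forall>\<^sub>F x in V n l. E k (Suc n) (x # l)" using that ES by blast
    ultimately have "\<exists>x. \<forall>k. E k (Suc n) (x # l)"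
      using eventually_countable [of "TYPE('v)" "V n l" "\<lambda>k x. E k (Suc n) (x # l)"]
        eventually_happens_ccuf by blast
    then show ?thesis by (metis list.sel(3))
  qed
  obtain L where L: "\<And>n. \<forall>k. E k n (L n)" "\<And>n. tl (L (Suc n)) = L n"
    using dependent_nat_choice [of "\<lambda>n l. \<forall>k. E k n l" "\<lambda>n l l'. tl l' = l"] start step by metis
  have "f (Suc n) (L (Suc n)) \<in> elts (f n (L n))" for n
    using L(1) [of "Suc n"] L(2) [of n] E0 [of "Suc n" "L (Suc n)"] by simp
  then show False using no_descending_chain [of "\<lambda>n. f n (L n)"] by blast
qed

section \<open>Ultrapowers by elements of the universe\<close>

text \<open>The exchange property alone forces almost every \<open>Q d\<close> to be a countably complete ultrafilter.\<close>

lemma internalI_quantifier: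
  fixes F :: "'a filter" and D :: "'b filter" and Q :: "'b \<Rightarrow> ('a \<Rightarrow> bool) \<Rightarrow> bool"
  assumes F: "ccuf TYPE('v::zfc) F" and D: "ccuf TYPE('v) D"
    and comm: "\<And>\<phi>. (\<forall>\<^sub>F a in F. \<forall>\<^sub>F d in D. \<phi> a d) \<longleftrightarrow> (\<forall>\<^sub>F d in D. Q d (\<lambda>a. \<phi> a d))"
  shows "internal TYPE('v) F D"
proof -
  note Q = comm [where \<phi> = "\<lambda>a d. p d a" for p, symmetric]
  have Q_True: "\<forall>\<^sub>F d in D. Q d (\<lambda>a. True)"
    using comm [of "\<lambda>_ _. True"] by simp
  have Q_False: "\<forall>\<^sub>F d in D. \<not> Q d (\<lambda>a. False)"
    using comm [of "\<lambda>_ _. False"]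
    by (simp add: eventually_not [OF D] eventually_const_iff [OF F] eventually_const_iff [OF D])
  \<comment> \<open>By \<open>eventually_all_iff\<close>, a quantifier over predicates inside "for
    almost all \<open>d\<close>" is one over families \<open>p\<close>, and to these
    \<open>comm\<close> applies. The other closure properties of \<open>Q d\<close> are obtained in
    the same way.\<close>
  have Q_conj: "\<forall>\<^sub>F d in D. \<forall>P P'. Q d P \<and> Q d P' \<longrightarrow> Q d (\<lambda>a. P a \<and> P' a)"
  proof (subst eventually_all_iff [OF D], intro allI, subst eventually_all_iff [OF D], intro allI)
    fix p p' :: "'b \<Rightarrow> 'a \<Rightarrow> bool"
    show "\<forall>\<^sub>F d in D. Q d (p d) \<and> Q d (p' d) \<longrightarrow> Q d (\<lambda>a. p d a \<and> p' d a)"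
      using Q [of p] Q [of p'] Q [of "\<lambda>d a. p d a \<and> p' d a"]
      by (simp add: eventually_imp [OF D] eventually_conj_iff)
  qed
  have Q_mono: "\<forall>\<^sub>F d in D. \<forall>P P'. (\<forall>a. P a \<longrightarrow> P' a) \<and> Q d P \<longrightarrow> Q d P'"
  proof (subst eventually_all_iff [OF D], intro allI, subst eventually_all_iff [OF D], intro allI)
    fix p p' :: "'b \<Rightarrow> 'a \<Rightarrow> bool"
    have "\<forall>\<^sub>F d in D. Q d (p' d)"
      if "\<forall>\<^sub>F d in D. \<forall>a. p d a \<longrightarrow> p' d a" "\<forall>\<^sub>F d in D. Q d (p d)"
    proof -
      have "\<forall>\<^sub>F a in F. \<forall>\<^sub>F d in D. p d a" using that(2) Q [of p] by simp
      then have "\<forall>\<^sub>F a in F. \<forall>\<^sub>F d in D. p' d a"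
      proof (rule eventually_mono)
        fix a assume "\<forall>\<^sub>F d in D. p d a"
        with that(1) show "\<forall>\<^sub>F d in D. p' d a" by eventually_elim blast
      qed
      then show ?thesis using Q [of p'] by simp
    qed
    then show "\<forall>\<^sub>F d in D. (\<forall>a. p d a \<longrightarrow> p' d a) \<and> Q d (p d) \<longrightarrow> Q d (p' d)"
      by (simp add: eventually_imp [OF D] eventually_conj_iff)
  qed
  have Q_ultra: "\<forall>\<^sub>F d in D. \<forall>P. Q d P \<or> Q d (\<lambda>a. \<not> P a)"
  proof (subst eventually_all_iff [OF D], intro allI)
    fix p :: "'b \<Rightarrow> 'a \<Rightarrow> bool"
    show "\<forall>\<^sub>F d in D. Q d (p d) \<or> Q d (\<lambda>a. \<not> p d a)"
      using Q [of p] Q [of "\<lambda>d a. \<not> p d a"]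
      by (simp add: eventually_disj [OF D] eventually_not [OF D] eventually_not [OF F])
  qed
  have Q_countable: "\<forall>\<^sub>F d in D. \<forall>P :: nat \<Rightarrow> 'a \<Rightarrow> bool. (\<forall>n. Q d (P n)) \<longrightarrow> Q d (\<lambda>a. \<forall>n. P n a)"
  proof (subst eventually_all_iff [OF D], intro allI)
    fix p :: "'b \<Rightarrow> nat \<Rightarrow> 'a \<Rightarrow> bool"
    show "\<forall>\<^sub>F d in D. (\<forall>n. Q d (p d n)) \<longrightarrow> Q d (\<lambda>a. \<forall>n. p d n a)"
      using Q [of "\<lambda>d. p d n" for n] Q [of "\<lambda>d a. \<forall>n. p d n a"]
      by (simp add: eventually_imp [OF D] eventually_countable [OF D] eventually_countable [OF F])
  qed
  obtain A where A: "vsmall TYPE('v) A" "\<forall>\<^sub>F a in F. a \<in> A"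
    using F unfolding ccuf_def by blast
  have Q_small: "\<forall>\<^sub>F d in D. Q d (\<lambda>a. a \<in> A)"
    using A(2) comm [of "\<lambda>a _. a \<in> A"] by (simp add: eventually_const_iff [OF D])
  define F' where "F' d = Abs_filter (Q d)" for d
  have F': "\<forall>\<^sub>F d in D. \<forall>P. eventually P (F' d) \<longleftrightarrow> Q d P"
    using Q_True Q_conj Q_mono
  proof eventually_elim
    case (elim d)
    have "is_filter (Q d)"
    proof
      show "Q d (\<lambda>x. True)" using elim(1) .
      show "Q d (\<lambda>x. P x \<and> P' x)" if "Q d P" "Q d P'" for P P' using elim(2) that by blast
      show "Q d P'" if "\<forall>x. P x \<longrightarrow> P' x" "Q d P" for P P' using elim(3) that by blast
    qed
    then show ?case by (simp add: F'_def eventually_Abs_filter)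
  qed
  have "\<forall>\<^sub>F d in D. ccuf TYPE('v) (F' d)"
    using F' Q_False Q_ultra Q_countable Q_small
  proof eventually_elim
    case (elim d)
    show ?case
      unfolding ccuf_def
    proof (intro conjI)
      show "F' d \<noteq> bot" using elim(1,2) by (metis eventually_bot)
    qed (use elim A(1) in auto)
  qed
  moreover have "(\<forall>\<^sub>F a in F. \<forall>\<^sub>F d in D. \<phi> a d) \<longleftrightarrow> (\<forall>\<^sub>F d in D. \<forall>\<^sub>F a in F' d. \<phi> a d)" for \<phi>
    unfolding comm by (rule eventually_subst, rule eventually_mono [OF F']) simp
  ultimately show ?thesis unfolding internal_def by blast
qed

text \<open>Let \<open>s\<close> be represented modulo \<open>A\<close> by the function sending
  \<open>a\<close> to j_B(a). The ultrafilter to be found in the ultrapower by \<open>B\<close>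
  consists of the \<open>C\<close> with \<open>s\<close> in j_A(C). It is defined there from
  \<open>s\<close> and \<open>r\<close>, the restriction of j_A to the image of the power set of
  \<open>?S\<close> under j_B.\<close>

lemma internal_rel_imp_internal:
  fixes A B :: "'v::zfc"
  assumes A: "cc_ultrafilter UNIV A" and B: "cc_ultrafilter UNIV B"
    and I: "internal_rel UNIV A B"
  shows "internal TYPE('v) (filt A) (filt B)"
proof -
  note cA = ccuf_filt [OF A] and cB = ccuf_filt [OF B]
  let ?S = "underlying A"
  define Pw where "Pw = set_of {y. elts y \<subseteq> elts ?S}"
  have Pw: "y \<in> elts Pw \<longleftrightarrow> elts y \<subseteq> elts ?S" for y
    by (simp add: Pw_def small_Pow)
  define x where "x = pt (filt B) (\<lambda>_. Pw)"
  define r where "r = restrict_fun (ult_emb UNIV A) x"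
  have "r \<in> range (pt (filt B))"
    using I unfolding internal_rel_def ultrapower_UNIV [OF B] r_def x_def by blast
  then obtain \<rho> where \<rho>: "r = pt (filt B) \<rho>" by blast
  have is_fun_\<rho>: "\<forall>\<^sub>F b in filt B. is_fun (\<rho> b) Pw"
  proof -
    have "is_fun r x" unfolding r_def by (rule is_fun_restrict_fun)
    then show ?thesis by (simp add: \<rho> x_def pt_is_fun [OF cB])
  qed
  define s where "s = pt (filt A) (\<lambda>a. pt (filt B) (\<lambda>_. a))"
  have mem_s: "s \<in> elts (ult_emb UNIV A (pt (filt B) C)) \<longleftrightarrow> (\<forall>\<^sub>F a in filt A. \<forall>\<^sub>F b in filt B. a \<in> elts (C b))" for C
    by (simp add: s_def ult_emb_UNIV [OF A] pt_mem_iff [OF cA] pt_mem_iff [OF cB])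
  \<comment> \<open>\<open>s\<close> is an element of j_A(j_B(\<open>?S\<close>)), which is the
    second component of a pair in \<open>r\<close>.\<close>
  have "s \<in> range (pt (filt B))"
  proof -
    define p where "p = pt (filt B) (\<lambda>_. ?S)"
    have "p \<in> elts x" by (simp add: p_def x_def pt_mem_iff [OF cB] Pw)
    then have "opair p (ult_emb UNIV A p) \<in> elts r" by (simp add: r_def elts_restrict_fun)
    then have "opair p (ult_emb UNIV A p) \<in> range (pt (filt B))"
      using range_pt_transitive [OF cB] \<rho> by blast
    then have "ult_emb UNIV A p \<in> range (pt (filt B))" by (rule opair_in_range [OF cB])
    moreover have "s \<in> elts (ult_emb UNIV A p)"
      using eventually_filt_underlying [OF A]
      by (simp add: p_def mem_s eventually_const_iff [OF cB])
    ultimately show ?thesis using range_pt_transitive [OF cB] by blast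
  qed
  then obtain \<sigma> where \<sigma>: "s = pt (filt B) \<sigma>" by blast
  define Q where "Q b P \<longleftrightarrow> \<sigma> b \<in> elts (app (\<rho> b) (set_of {a \<in> elts ?S. P a}))" for b P
  show ?thesis
  proof (rule internalI_quantifier [OF cA cB])
    fix \<phi> :: "'v \<Rightarrow> 'v \<Rightarrow> bool"
    define C where "C b = set_of {a \<in> elts ?S. \<phi> a b}" for b
    have C: "C b \<in> elts Pw" for b by (auto simp: Pw C_def)
    have "(\<forall>\<^sub>F a in filt A. \<forall>\<^sub>F b in filt B. \<phi> a b) \<longleftrightarrow> (\<forall>\<^sub>F a in filt A. \<forall>\<^sub>F b in filt B. a \<in> elts (C b))"
      by (rule eventually_subst, rule eventually_mono [OF eventually_filt_underlying [OF A]])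
        (simp add: C_def)
    also have "\<dots> \<longleftrightarrow> s \<in> elts (ult_emb UNIV A (pt (filt B) C))" by (simp add: mem_s)
    also have "ult_emb UNIV A (pt (filt B) C) = app r (pt (filt B) C)"
      by (simp add: r_def x_def pt_mem_iff [OF cB] C)
    also have "\<dots> = pt (filt B) (\<lambda>b. app (\<rho> b) (C b))"
      unfolding \<rho> by (rule pt_app [OF cB is_fun_\<rho>]) (simp add: C)
    also have "s \<in> elts \<dots> \<longleftrightarrow> (\<forall>\<^sub>F b in filt B. Q b (\<lambda>a. \<phi> a b))"
      by (simp add: \<sigma> pt_mem_iff [OF cB] Q_def C_def)
    finally show "(\<forall>\<^sub>F a in filt A. \<forall>\<^sub>F b in filt B. \<phi> a b) \<longleftrightarrow> (\<forall>\<^sub>F b in filt B. Q b (\<lambda>a. \<phi> a b))" .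
  qed
qed

lemma pt_internal_rel:
  fixes A B :: "'a \<Rightarrow> 'v::zfc"
  assumes F: "ccuf TYPE('v) F" and A: "\<forall>\<^sub>F x in F. cc_ultrafilter UNIV (A x)"
    and B: "\<forall>\<^sub>F x in F. cc_ultrafilter UNIV (B x)"
    and I: "internal_rel (range (pt F)) (pt F A) (pt F B)"
  shows "\<forall>\<^sub>F x in F. internal_rel UNIV (A x) (B x)"
proof -
  let ?M = "range (pt F) :: 'v set"
  have cA: "\<forall>\<^sub>F x in F. ccuf TYPE('v) (filt (A x))"
    by (rule eventually_mono [OF A], erule ccuf_filt)
  have cB: "\<forall>\<^sub>F x in F. ccuf TYPE('v) (filt (B x))"
    by (rule eventually_mono [OF B], erule ccuf_filt)
  have mem: "pt F y \<in> ultrapower ?M (pt F B) \<longleftrightarrow> (\<forall>\<^sub>F x in F. y x \<in> ultrapower UNIV (B x))" for y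
    unfolding ultrapower_range_pt [OF F B] pt_mem_range_dsum [OF F cB]
    by (rule eventually_subst, rule eventually_mono [OF B]) (simp add: ultrapower_UNIV)
  have emb: "ult_emb ?M (pt F A) (pt F y) = pt F (\<lambda>x. ult_emb UNIV (A x) (y x))" for y
    unfolding ult_emb_pt [OF F A] pt_dsum [OF F cA]
    by (rule pt_cong [OF F], rule eventually_mono [OF A]) (simp add: ult_emb_UNIV)
  have "\<forall>\<^sub>F x in F. y x \<in> ultrapower UNIV (B x) \<longrightarrow>
      restrict_fun (ult_emb UNIV (A x)) (y x) \<in> ultrapower UNIV (B x)" for y
  proof -
    have "restrict_fun (ult_emb ?M (pt F A)) (pt F y) = pt F (\<lambda>x. restrict_fun (ult_emb UNIV (A x)) (y x))"
      by (rule pt_restrict_fun [OF F]) (rule emb)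
    then show ?thesis
      using I unfolding internal_rel_def by (auto simp: eventually_imp [OF F] simp flip: mem)
  qed
  then show ?thesis
    unfolding internal_rel_def Ball_def by (simp only: eventually_all_iff [OF F]) blast
qed

section \<open>The twice iterated ultrapower and the two images of \<open>W\<close> in it\<close>

context
  fixes U :: "'v::zfc"
  assumes U: "cc_ultrafilter UNIV U"
begin

text \<open>A function with values in \<open>C\<close> almost everywhere is caught by the piece
  \<open>C \<inter> elts x\<close> whose \<open>x\<close> is the set of its values.\<close>

lemma class_image_embV: "class_image (embV U) C = {pt (filt U) g |g. \<forall>\<^sub>F a in filt U. g a \<in> C}"
proof (intro equalityI subsetI)
  note c = ccuf_filt [OF U]
  fix y assume "y \<in> class_image (embV U) C"
  then obtain x where "y \<in> elts (pt (filt U) (\<lambda>_. set_of (C \<inter> elts x)))"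
    by (auto simp: class_image_def ult_emb_UNIV [OF U])
  then obtain g where g: "y = pt (filt U) g" "\<forall>\<^sub>F a in filt U. g a \<in> elts (set_of (C \<inter> elts x))"
    by (rule mem_ptE [OF c])
  have "elts (set_of (C \<inter> elts x)) = C \<inter> elts x"
    by (rule elts_set_of, rule small_subset [OF small_elts, of _ x]) auto
  then have "\<forall>\<^sub>F a in filt U. g a \<in> C" using g(2) by (auto elim: eventually_mono)
  then show "y \<in> {pt (filt U) g |g. \<forall>\<^sub>F a in filt U. g a \<in> C}" using g(1) by blast
next
  note c = ccuf_filt [OF U]
  fix y assume "y \<in> {pt (filt U) g |g. \<forall>\<^sub>F a in filt U. g a \<in> C}"
  then obtain g where g: "y = pt (filt U) g" "\<forall>\<^sub>F a in filt U. g a \<in> C" by blast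
  define x where "x = set_of (g ` elts (underlying U))"
  have x: "elts (set_of (C \<inter> elts x)) = C \<inter> elts x" by (rule elts_set_of, rule small_subset [OF small_elts, of _ x]) auto
  have "\<forall>\<^sub>F a in filt U. g a \<in> elts (set_of (C \<inter> elts x))"
    using g(2) eventually_filt_underlying [OF U]
    by eventually_elim (subst x, simp add: x_def)
  then have "y \<in> elts (embV U (set_of (C \<inter> elts x)))"
    by (simp add: g(1) ult_emb_UNIV [OF U] pt_mem_iff [OF c])
  then show "y \<in> class_image (embV U) C" unfolding class_image_def by blast
qed

lemma ult_sq_eq: "ult_sq U = range (pt (dsum (filt U) (\<lambda>_. filt U)))"
proof -
  note c = ccuf_filt [OF U]
  have c': "\<forall>\<^sub>F _ in filt U. ccuf TYPE('v) (filt U)" by (simp add: c)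
  have "y \<in> ult_sq U \<longleftrightarrow> y \<in> range (pt (dsum (filt U) (\<lambda>_. filt U)))" for y
  proof
    assume "y \<in> ult_sq U"
    then obtain g where "y = pt (filt U) g" "\<forall>\<^sub>F a in filt U. g a \<in> range (pt (filt U))"
      by (auto simp: ult_sq_def class_image_embV ultrapower_UNIV [OF U])
    then show "y \<in> range (pt (dsum (filt U) (\<lambda>_. filt U)))"
      by (simp only: pt_mem_range_dsum [OF c c'])
  next
    assume y: "y \<in> range (pt (dsum (filt U) (\<lambda>_. filt U)))"
    then obtain g where g: "y = pt (filt U) g" using range_pt_dsum_subset [OF c c'] by blast
    then have "\<forall>\<^sub>F a in filt U. g a \<in> range (pt (filt U))"
      using y by (simp only: pt_mem_range_dsum [OF c c'])
    then show "y \<in> ult_sq U"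
      using g by (auto simp: ult_sq_def class_image_embV ultrapower_UNIV [OF U])
  qed
  then show ?thesis by blast
qed

text \<open>In the pair (\<alpha>, \<beta>) the outer coordinate is \<alpha>. The embedding
  \<open>embV U\<close> is constant in \<alpha>, so \<open>w\<close> is read at \<beta>;
  \<open>emb_of_emb U\<close> applies the embedding in each fibre, so there \<open>w\<close> is read
  at \<alpha>. This fixes the order \<open>w \<beta> I w \<alpha>\<close> in the hypothesis.\<close>

lemma embV_pt:
  "embV U (pt (filt U) w) = pt (dsum (filt U) (\<lambda>_. filt U)) (\<lambda>(\<alpha>, \<beta>). w \<beta>)"
  by (simp add: ult_emb_UNIV [OF U] pt_dsum [OF ccuf_filt [OF U]] ccuf_filt [OF U])

lemma emb_of_emb_pt:
  "emb_of_emb U (pt (filt U) w) = pt (dsum (filt U) (\<lambda>_. filt U)) (\<lambda>(\<alpha>, \<beta>). w \<alpha>)"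
proof -
  note c = ccuf_filt [OF U]
  let ?y = "pt (filt U) (\<lambda>\<alpha>. embV U (w \<alpha>))"
  have "opair (pt (filt U) w) y \<in> class_image (embV U) (class_graph (embV U)) \<longleftrightarrow> y = ?y" for y
  proof
    assume "opair (pt (filt U) w) y \<in> class_image (embV U) (class_graph (embV U))"
    then obtain g where g: "opair (pt (filt U) w) y = pt (filt U) g"
      "\<forall>\<^sub>F a in filt U. \<exists>x. g a = opair x (embV U x)"
      by (auto simp: class_image_embV class_graph_def image_iff)
    then obtain x where x: "\<forall>\<^sub>F a in filt U. g a = opair (x a) (embV U (x a))"
      unfolding eventually_ex_iff by blast
    then have "opair (pt (filt U) w) y = opair (pt (filt U) x) (pt (filt U) (\<lambda>a. embV U (x a)))"
      using pt_cong [OF c x] g(1) by (simp add: pt_opair [OF c])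
    then have y: "y = pt (filt U) (\<lambda>a. embV U (x a))" and "\<forall>\<^sub>F a in filt U. w a = x a"
      by (simp_all add: pt_eq_iff [OF c])
    from this(2) show "y = ?y"
      unfolding y by (intro pt_cong [OF c]) (erule eventually_mono, simp)
  next
    assume "y = ?y"
    then have "opair (pt (filt U) w) y = pt (filt U) (\<lambda>a. opair (w a) (embV U (w a)))"
      by (simp add: pt_opair [OF c])
    then show "opair (pt (filt U) w) y \<in> class_image (embV U) (class_graph (embV U))"
      unfolding class_image_embV class_graph_def by auto
  qed
  then have "emb_of_emb U (pt (filt U) w) = ?y"
    by (simp add: emb_of_emb_def class_app_def)
  also have "\<dots> = pt (dsum (filt U) (\<lambda>_. filt U)) (\<lambda>(\<alpha>, \<beta>). w \<alpha>)"
    by (simp add: ult_emb_UNIV [OF U] pt_dsum [OF c] c)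
  finally show ?thesis .
qed

end

lemma Unif_cc_ultrafilter: "Z \<in> Unif M \<Longrightarrow> cc_ultrafilter M Z"
  unfolding Unif_def cc_ultrafilter_def by blast

theorem mainTheorem9:
  fixes U W :: "'v::zfc"
  assumes "ultrapower_axiom (UNIV :: 'v set)"
    and "U \<in> Unif UNIV"
    and "W \<in> Unif (ultV U)"
    and "internal_rel (ult_sq U) (embV U W) (emb_of_emb U W)"
  shows "\<forall>\<xi>. Ord \<xi> \<longrightarrow> ult_emb (ultV U) W (embV U \<xi>) = embV U \<xi>"
proof (intro allI impI)
  fix \<xi> :: 'v assume \<xi>: "Ord \<xi>"
  have U: "cc_ultrafilter UNIV U" by (rule Unif_cc_ultrafilter [OF assms(2)])
  note c = ccuf_filt [OF U]
  have W: "cc_ultrafilter (range (pt (filt U))) W"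
    using Unif_cc_ultrafilter [OF assms(3)] by (simp add: ultrapower_UNIV [OF U])
  then have "W \<in> range (pt (filt U))"
    by (auto simp: cc_ultrafilter_def ultrafilter_on_def)
  then obtain w where w: "W = pt (filt U) w" by blast
  have ccw: "\<forall>\<^sub>F \<alpha> in filt U. cc_ultrafilter UNIV (w \<alpha>)"
    using W by (simp add: w pt_cc_ultrafilter [OF c])
  have cw: "\<forall>\<^sub>F \<alpha> in filt U. ccuf TYPE('v) (filt (w \<alpha>))"
    by (rule eventually_mono [OF ccw], erule ccuf_filt)
  have cUU: "ccuf TYPE('v) (dsum (filt U) (\<lambda>_. filt U))"
    by (rule ccuf_dsum [OF c]) (simp add: c)
  have ccw2: "\<forall>\<^sub>F p in dsum (filt U) (\<lambda>_. filt U). cc_ultrafilter UNIV ((\<lambda>(\<alpha>, \<beta>). w \<beta>) p)"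
    "\<forall>\<^sub>F p in dsum (filt U) (\<lambda>_. filt U). cc_ultrafilter UNIV ((\<lambda>(\<alpha>, \<beta>). w \<alpha>) p)"
    using ccw by (simp_all add: eventually_dsum eventually_const_iff [OF c])
  have "\<forall>\<^sub>F p in dsum (filt U) (\<lambda>_. filt U).
      internal_rel UNIV ((\<lambda>(\<alpha>, \<beta>). w \<beta>) p) ((\<lambda>(\<alpha>, \<beta>). w \<alpha>) p)"
    using assms(4) by (intro pt_internal_rel cUU ccw2) (simp add: w ult_sq_eq [OF U] embV_pt [OF U] emb_of_emb_pt [OF U])
  with ccw2 have "\<forall>\<^sub>F p in dsum (filt U) (\<lambda>_. filt U).
      internal TYPE('v) (filt ((\<lambda>(\<alpha>, \<beta>). w \<beta>) p)) (filt ((\<lambda>(\<alpha>, \<beta>). w \<alpha>) p))"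
    by eventually_elim (rule internal_rel_imp_internal)
  then have I: "\<forall>\<^sub>F \<alpha> in filt U. \<forall>\<^sub>F \<beta> in filt U. internal TYPE('v) (filt (w \<beta>)) (filt (w \<alpha>))"
    by (simp add: eventually_dsum)
  have "\<forall>\<^sub>F \<alpha> in filt U. pt (filt (w \<alpha>)) (\<lambda>_. \<xi>) = \<xi>"
  proof (rule ccontr)
    assume "\<not> ?thesis"
    then have moved: "\<forall>\<^sub>F \<alpha> in filt U. pt (filt (w \<alpha>)) (\<lambda>_. \<xi>) \<noteq> \<xi>"
      by (simp add: eventually_not [OF c])
    \<comment> \<open>The last clause makes almost every \<beta> an admissible successor of
      \<alpha>, so finitely many earlier points still leave a large set of choices.\<close>
    define R where "R \<alpha> \<longleftrightarrow> ccuf TYPE('v) (filt (w \<alpha>)) \<and> pt (filt (w \<alpha>)) (\<lambda>_. \<xi>) \<noteq> \<xi> \<and>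
        (\<forall>\<^sub>F \<beta> in filt U. internal TYPE('v) (filt (w \<beta>)) (filt (w \<alpha>)))" for \<alpha>
    have R: "\<forall>\<^sub>F \<alpha> in filt U. R \<alpha>"
      using cw moved I by eventually_elim (simp add: R_def)
    define good where "good l \<longleftrightarrow> (\<forall>\<alpha>\<in>set l. R \<alpha>)" for l
    define next_pt where "next_pt l = (SOME \<beta>. R \<beta> \<and>
        (\<forall>\<alpha>\<in>set l. internal TYPE('v) (filt (w \<beta>)) (filt (w \<alpha>))))" for l
    have next_pt: "R (next_pt l) \<and> (\<forall>\<alpha>\<in>set l. internal TYPE('v) (filt (w (next_pt l))) (filt (w \<alpha>)))"
      if "good l" for l
    proof -
      have "\<forall>\<^sub>F \<beta> in filt U. \<forall>\<alpha>\<in>set l. internal TYPE('v) (filt (w \<beta>)) (filt (w \<alpha>))"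
        using that by (intro eventually_ball_finite) (auto simp: good_def R_def)
      with R have "\<forall>\<^sub>F \<beta> in filt U. R \<beta> \<and> (\<forall>\<alpha>\<in>set l. internal TYPE('v) (filt (w \<beta>)) (filt (w \<alpha>)))"
        by (rule eventually_conj)
      then have "\<exists>\<beta>. R \<beta> \<and> (\<forall>\<alpha>\<in>set l. internal TYPE('v) (filt (w \<beta>)) (filt (w \<alpha>)))"
        by (rule eventually_happens_ccuf [OF c])
      then show ?thesis unfolding next_pt_def by (rule someI_ex)
    qed
    \<comment> \<open>The whole history is kept, since the new ultrafilter has to be internal to all
      earlier ones.\<close>
    define hist where "hist = rec_nat [] (\<lambda>_ l. next_pt l # l)"
    have hist: "hist 0 = []" "hist (Suc n) = next_pt (hist n) # hist n" for n
      by (simp_all add: hist_def)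
    have good: "good (hist n)" for n
    proof (induction n)
      case (Suc n)
      then show ?case using next_pt [of "hist n"] by (simp add: hist good_def)
    qed (simp add: hist good_def)
    define \<alpha> where "\<alpha> n = next_pt (hist n)" for n
    have \<alpha>_hist: "\<alpha> m \<in> set (hist n)" if "m < n" for m n
      using that by (induction n) (auto simp: hist \<alpha>_def less_Suc_eq)
    have R\<alpha>: "R (\<alpha> n)" for n using next_pt [OF good] by (simp add: \<alpha>_def)
    have "\<exists>n. pt (filt (w (\<alpha> n))) (\<lambda>_. \<xi>) = \<xi>"
    proof (rule internal_sequence_fixes_Ord [OF assms(1) _ _ \<xi>])
      show "ccuf TYPE('v) (filt (w (\<alpha> n)))" for n using R\<alpha> [of n] by (simp add: R_def)
      show "internal TYPE('v) (filt (w (\<alpha> n))) (filt (w (\<alpha> m)))" if "m < n" for m n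
        using next_pt [OF good, of n] \<alpha>_hist [OF that] by (simp add: \<alpha>_def)
    qed
    then show False using R\<alpha> by (auto simp: R_def)
  qed
  \<comment> \<open>The left side is represented by the function sending \<alpha> to the image of
    \<xi> under the embedding of \<open>w \<alpha>\<close>, the right side by the constant
    \<xi>.\<close>
  then show "ult_emb (ultV U) W (embV U \<xi>) = embV U \<xi>"
    by (simp add: w ultrapower_UNIV [OF U] ult_emb_UNIV [OF U] ult_emb_pt [OF c ccw]
        pt_dsum [OF c cw] pt_eq_iff [OF c])
qed

end
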